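(* Let $V$ be a vector space of finite dimension $m$ over a local field $k$. (i) If $k=\mathbb{R}$ and $\nu$ is a positive definite quadratic form on $V$, then $x\mapsto|\nu(x)|^{1/2}$ is a norm on $V$. (ii) If $k$ is non-archimedean and $r$ is a positive integer such that $r^2\ge m$, then there is a homogeneous polynomial $\nu\colon V\to k$ of degree $r$ such that (a) $\nu$ is definite, i.e. for $x\in V$, $\nu(x)=0$ if and only if $x=0$; (b) $x\mapsto|\nu(x)|^{1/r}$ is a non-archimedean norm on $V$.
   Context: A local field is a locally compact non-discrete topological field of any characteristic, other than $\mathbb{C}$; $|\cdot|$ is its canonical absolute value. A non-archimedean norm is a norm satisfying $\|x+y\|\le\max(\|x\|,\|y\|)$ and $\|ax\|=|a|\,\|x\|$. *)

theory Defs
  imports "HOL-Analysis.Analysis"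
begin

class topological_field = field + t2_space + topological_ab_group_add + topological_semigroup_mult +
  assumes tendsto_inverse_nhds: "a \<noteq> 0 \<Longrightarrow> LIM x nhds a. inverse x :> nhds (inverse a)"

definition topological_field_iso :: "('a::topological_field \<Rightarrow> 'b::topological_field) \<Rightarrow> bool" where
  "topological_field_iso f \<longleftrightarrow>
     f 1 = 1 \<and> (\<forall>x y. f (x + y) = f x + f y) \<and> (\<forall>x y. f (x * y) = f x * f y) \<and>
     bij f \<and> continuous_on UNIV f \<and> continuous_on UNIV (inv f)"

instance real :: topological_field
  by standard (rule tendsto_inverse[OF filterlim_ident])

instance complex :: topological_field
  by standard (rule tendsto_inverse[OF filterlim_ident])

definition local_field :: "'k::topological_field itself \<Rightarrow> bool" where
  "local_field _ \<longleftrightarrow>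
     locally compact (UNIV :: 'k set) \<and>
     \<not> (\<forall>S :: 'k set. open S) \<and>
     (\<nexists>f :: 'k \<Rightarrow> complex. topological_field_iso f)"

lemma local_field_real: "local_field TYPE(real)"
  unfolding local_field_def
proof (intro conjI)
  show "locally compact (UNIV :: real set)"
    by (simp add: open_imp_locally_compact)
  show "\<not> (\<forall>S :: real set. open S)"
    using not_open_singleton by blast
  show "\<nexists>f :: real \<Rightarrow> complex. topological_field_iso f"
  proof
    assume "\<exists>f :: real \<Rightarrow> complex. topological_field_iso f"
    then obtain f :: "real \<Rightarrow> complex" where f: "topological_field_iso f" by blast
    have add: "f (x + y) = f x + f y" and mult: "f (x * y) = f x * f y" and one: "f 1 = 1" for x y
      using f by (auto simp: topological_field_iso_def)
    have "f 0 = 0" using add[of 0 0] by simp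
    obtain a where a: "f a = \<i>" using f by (metis topological_field_iso_def bij_pointE)
    have "f (a * a + 1) = f 0"
      by (simp only: add mult one a \<open>f 0 = 0\<close>) simp
    then have "a * a + 1 = 0" using f by (metis topological_field_iso_def bij_is_inj injD)
    then show False by (metis add_nonneg_pos less_irrefl zero_le_square zero_less_one)
  qed
qed

definition haar_measure :: "'a::{topological_ab_group_add, t2_space} measure \<Rightarrow> bool" where
  "haar_measure \<mu> \<longleftrightarrow>
     sets \<mu> = sets borel \<and>
     emeasure \<mu> UNIV \<noteq> 0 \<and>
     (\<forall>K. compact K \<longrightarrow> emeasure \<mu> K < \<infinity>) \<and>
     (\<forall>X \<in> sets borel. emeasure \<mu> X = (INF U \<in> {U. open U \<and> X \<subseteq> U}. emeasure \<mu> U)) \<and>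
     (\<forall>U. open U \<longrightarrow> emeasure \<mu> U = (SUP K \<in> {K. compact K \<and> K \<subseteq> U}. emeasure \<mu> K)) \<and>
     (\<forall>a. \<forall>X \<in> sets borel. emeasure \<mu> ((+) a ` X) = emeasure \<mu> X)"

text \<open>
  The canonical (normalised) absolute value is the factor by which multiplication scales Haar
  measure.  As Haar measure exists and is unique up to a positive scalar, on a locally compact
  non-discrete field exactly one function
  satisfies this predicate.  For a non-archimedean field it sends a uniformiser to the inverse of
  the order of the residue field; for the reals it is the usual absolute value, as proved below.
  (For the complex numbers one would get the square of the modulus, which violates the triangle
  inequality.)
\<close>
definition canonical_abs_value :: "('k::topological_field \<Rightarrow> real) \<Rightarrow> bool" where
  "canonical_abs_value v \<longleftrightarrow>
     (\<forall>a. 0 \<le> v a) \<and>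
     (\<exists>\<mu>. haar_measure \<mu> \<and>
        (\<forall>a. \<forall>X \<in> sets borel. emeasure \<mu> ((*) a ` X) = ennreal (v a) * emeasure \<mu> X))"

definition nonarchimedean_abs_value :: "('k::topological_field \<Rightarrow> real) \<Rightarrow> bool" where
  "nonarchimedean_abs_value v \<longleftrightarrow> canonical_abs_value v \<and> (\<forall>a b. v (a + b) \<le> max (v a) (v b))"

lemma haar_measure_lborel: "haar_measure (lborel :: real measure)"
  unfolding haar_measure_def
proof (intro conjI allI impI ballI)
  fix X :: "real set" assume X: "X \<in> sets borel"
  show "emeasure lborel X = (INF U \<in> {U. open U \<and> X \<subseteq> U}. emeasure lborel U)"
  proof (rule antisym)
    show "emeasure lborel X \<le> (INF U \<in> {U. open U \<and> X \<subseteq> U}. emeasure lborel U)"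
      by (auto intro!: INF_greatest emeasure_mono)
    show "(INF U \<in> {U. open U \<and> X \<subseteq> U}. emeasure lborel U) \<le> emeasure lborel X"
    proof (rule ennreal_le_epsilon)
      fix e :: real assume "0 < e"
      then obtain U where U: "open U" "X \<subseteq> U" "emeasure lborel (U - X) < e"
        using outer_regular_lborel[OF X] by blast
      have "(INF U \<in> {U. open U \<and> X \<subseteq> U}. emeasure lborel U) \<le> emeasure lborel U"
        using U by (auto intro: INF_lower)
      also have "\<dots> = emeasure lborel (X \<union> (U - X))"
        using U by (simp add: Un_absorb1)
      also have "\<dots> \<le> emeasure lborel X + emeasure lborel (U - X)"
        using U X by (intro emeasure_subadditive) auto
      also have "\<dots> \<le> emeasure lborel X + ennreal e"
        using U by (intro add_left_mono) auto
      finally show "(INF U \<in> {U. open U \<and> X \<subseteq> U}. emeasure lborel U) \<le> emeasure lborel X + ennreal e" .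
    qed
  qed
next
  fix U :: "real set" assume U: "open U"
  obtain C :: "nat \<Rightarrow> real set" where C: "\<And>n. compact (C n)" "\<And>n. C n \<subseteq> U"
      "\<And>n. C n \<subseteq> interior (C (Suc n))" "\<Union> (range C) = U"
    using open_Union_compact_subsets[OF U] by metis
  have "incseq C"
    using C(3) interior_subset by (blast intro: incseq_SucI)
  then have "emeasure lborel U = (SUP n. emeasure lborel (C n))"
    using C(1) C(4) by (subst SUP_emeasure_incseq) (auto intro: borel_compact)
  also have "\<dots> \<le> (SUP K \<in> {K. compact K \<and> K \<subseteq> U}. emeasure lborel K)"
    using C(1,2) by (auto intro!: SUP_mono)
  finally show "emeasure lborel U = (SUP K \<in> {K. compact K \<and> K \<subseteq> U}. emeasure lborel K)"
    using U by (intro antisym) (auto intro!: SUP_least emeasure_mono)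
next
  fix a :: real and X :: "real set" assume X: "X \<in> sets borel"
  have "(+) a ` X = (\<lambda>x. x - a) -` X"
    by (force simp: image_iff)
  moreover have "emeasure lborel ((\<lambda>x. - a + x) -` X) = emeasure (distr lborel borel ((+) (- a))) X"
    using X by (subst emeasure_distr) auto
  ultimately show "emeasure lborel ((+) a ` X) = emeasure lborel X"
    by (simp add: lborel_distr_plus)
next
  fix K :: "real set" assume "compact K"
  then show "emeasure lborel K < \<infinity>"
    by (rule emeasure_bounded_finite[OF compact_imp_bounded])
qed auto

lemma canonical_abs_value_real: "canonical_abs_value (abs :: real \<Rightarrow> real)"
  unfolding canonical_abs_value_def
proof (intro conjI allI exI ballI)
  show "haar_measure (lborel :: real measure)" by (rule haar_measure_lborel)
  fix a :: real and X :: "real set" assume X: "X \<in> sets borel"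
  show "emeasure lborel ((*) a ` X) = ennreal \<bar>a\<bar> * emeasure lborel X"
  proof (cases "a = 0")
    case True
    then have "(*) a ` X \<subseteq> {0}" by auto
    then have "emeasure lborel ((*) a ` X) \<le> emeasure lborel {0 :: real}"
      by (intro emeasure_mono) auto
    with True show ?thesis by simp
  next
    case False
    then have "(*) a ` X = (*) (inverse a) -` X"
      by (force simp: image_iff field_simps)
    then have "emeasure lborel ((*) a ` X) = emeasure (distr lborel borel ((*) (inverse a))) X"
      using X by (subst emeasure_distr) auto
    also have "\<dots> = ennreal \<bar>a\<bar> * emeasure lborel X"
      using False X by (subst lborel_distr_mult) (auto simp: emeasure_density nn_integral_cmult)
    finally show ?thesis .
  qed
qed auto

locale vector_norm = vector_space smul
  for v :: "'k::field \<Rightarrow> real"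
    and smul :: "'k \<Rightarrow> 'v::ab_group_add \<Rightarrow> 'v"
    and N :: "'v \<Rightarrow> real" +
  assumes nonneg: "0 \<le> N x"
    and eq_zero_iff: "N x = 0 \<longleftrightarrow> x = 0"
    and triangle: "N (x + y) \<le> N x + N y"
    and homogeneous: "N (smul a x) = v a * N x"

locale nonarchimedean_vector_norm = vector_norm +
  assumes ultrametric: "N (x + y) \<le> max (N x) (N y)"

text \<open>
  Homogeneous polynomials of degree \<open>r\<close>, written in the coordinates with respect to a
  finite basis \<open>B\<close>; \<open>\<alpha>\<close> ranges over the multi-indices of total degree \<open>r\<close> and \<open>c \<alpha>\<close> is the
  coefficient of the corresponding monomial.  The zero polynomial is homogeneous of every degree,
  and the notion does not depend on \<open>B\<close>.
\<close>
definition homogeneous_polynomial ::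
    "('k::field \<Rightarrow> 'v::ab_group_add \<Rightarrow> 'v) \<Rightarrow> 'v set \<Rightarrow> nat \<Rightarrow> ('v \<Rightarrow> 'k) \<Rightarrow> bool" where
  "homogeneous_polynomial smul B r \<nu> \<longleftrightarrow>
     (\<exists>c :: ('v \<Rightarrow> nat) \<Rightarrow> 'k. \<forall>x.
        \<nu> x = (\<Sum>\<alpha> \<in> {\<alpha>. (\<forall>b. b \<notin> B \<longrightarrow> \<alpha> b = 0) \<and> (\<Sum>b\<in>B. \<alpha> b) = r}.
                 c \<alpha> * (\<Prod>b\<in>B. module.representation smul B x b ^ \<alpha> b)))"

definition quadratic_form ::
    "('k::field \<Rightarrow> 'v::ab_group_add \<Rightarrow> 'v) \<Rightarrow> 'v set \<Rightarrow> ('v \<Rightarrow> 'k) \<Rightarrow> bool" where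
  "quadratic_form smul B \<nu> \<longleftrightarrow> homogeneous_polynomial smul B 2 \<nu>"

definition positive_definite :: "('v::zero \<Rightarrow> real) \<Rightarrow> bool" where
  "positive_definite \<nu> \<longleftrightarrow> (\<forall>x. x \<noteq> 0 \<longrightarrow> 0 < \<nu> x)"

definition definite :: "('v::zero \<Rightarrow> 'k::zero) \<Rightarrow> bool" where
  "definite \<nu> \<longleftrightarrow> (\<forall>x. \<nu> x = 0 \<longleftrightarrow> x = 0)"

end

theory Submission
  imports Defs "HOL-Algebra.Algebraic_Closure_Type" "HOL-Number_Theory.Residues"
begin

text \<open>
  The first part is the Cauchy--Schwarz inequality. For the second, let \<open>\<pi>\<close> be a uniformiser and
  \<open>q\<close> the (finite) order of the residue field. The norm form of the extension of degree \<open>r\<close> of the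
  residue field has degree \<open>r\<close>, is in \<open>r\<close> variables and vanishes only at \<open>0\<close>. Lifting its
  coefficients gives a form \<open>f\<close> of degree \<open>r\<close> with \<open>\<bar>f y\<bar> = (max\<^sub>j \<bar>y\<^sub>j\<bar>)\<^sup>r\<close>. For \<open>r\<close> blocks of \<open>r\<close>
  variables let \<open>\<nu> = f(y\<^sub>0) + \<pi> f(y\<^sub>1) + \<dots> + \<pi>\<^sup>r\<^sup>-\<^sup>1 f(y\<^sub>r\<^sub>-\<^sub>1)\<close>. The values of the nonzero summands are
  incongruent modulo \<open>r\<close>-th powers of \<open>\<bar>\<pi>\<bar>\<close>, hence distinct, so that
  \<open>\<bar>\<nu>\<bar> = max\<^sub>i \<bar>\<pi>\<bar>\<^sup>i (max\<^sub>j \<bar>y\<^sub>i\<^sub>j\<bar>)\<^sup>r\<close>. A space of dimension \<open>m \<le> r\<^sup>2\<close> embeds into the space of these variables.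

  Discreteness of the value group and finiteness of the residue field both follow from the unit ball
  having finite Haar measure.
\<close>

subsection \<open>The residue field\<close>

text \<open>A subring \<open>R\<close> and a proper ideal \<open>I\<close> such that the elements of
  \<open>R\<close> outside \<open>I\<close> are units of \<open>R\<close>: exactly what makes
  \<open>R\<close>/\<open>I\<close> a field. \<open>R\<close> need not be a valuation ring.\<close>

definition valuation_pair :: "'a::field set \<Rightarrow> 'a set \<Rightarrow> bool" where
  "valuation_pair R I \<longleftrightarrow>
     1 \<in> R \<and> 1 \<notin> I \<and> 0 \<in> I \<and> I \<subseteq> R \<and>
     (\<forall>x\<in>R. \<forall>y\<in>R. x - y \<in> R \<and> x * y \<in> R) \<and>
     (\<forall>x\<in>I. \<forall>y\<in>I. x - y \<in> I) \<and>
     (\<forall>x\<in>R. \<forall>y\<in>I. x * y \<in> I) \<and>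
     (\<forall>x\<in>R. x \<notin> I \<longrightarrow> inverse x \<in> R)"

text \<open>The topologically nilpotent elements; over a non-archimedean local field they form the
  maximal ideal.\<close>

definition nilpotents :: "'a::topological_field set" where
  "nilpotents = {x. (\<lambda>n. x ^ n) \<longlonglongrightarrow> 0}"

definition integers :: "'a::topological_field set" where
  "integers = {x. inverse x \<in> nilpotents \<longrightarrow> x = 0}"

text \<open>
  The residue field must be a type, since its algebraic closure is only available for types.
  A type cannot depend on an absolute value, so the valuation ring and its maximal ideal are
  described by the topology; where this fails to give a local ring, the pair \<open>(UNIV, {0})\<close>
  takes their place, and the quotient is still a field.
\<close>
definition residue_ring :: "'a::topological_field set" where
  "residue_ring = (if valuation_pair integers (nilpotents :: 'a set) then integers else UNIV)"

definition residue_ideal :: "'a::topological_field set" where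
  "residue_ideal = (if valuation_pair integers (nilpotents :: 'a set) then nilpotents else {0})"

lemma valuation_pair_residue:
  "valuation_pair (residue_ring :: 'a::topological_field set) residue_ideal"
proof (cases "valuation_pair integers (nilpotents :: 'a set)")
  case True
  then show ?thesis by (simp add: residue_ring_def residue_ideal_def)
next
  case False
  then have eq: "residue_ring = (UNIV :: 'a set)" "residue_ideal = ({0} :: 'a set)"
    by (simp_all add: residue_ring_def residue_ideal_def)
  show ?thesis unfolding eq valuation_pair_def by simp
qed

lemma
  shows residue_ring_1: "1 \<in> residue_ring"
    and residue_ideal_1: "1 \<notin> residue_ideal"
    and residue_ideal_0: "0 \<in> residue_ideal"
    and residue_ideal_subset: "x \<in> residue_ideal \<Longrightarrow> x \<in> residue_ring"
    and residue_ring_diff: "\<lbrakk>x \<in> residue_ring; y \<in> residue_ring\<rbrakk> \<Longrightarrow> x - y \<in> residue_ring"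
    and residue_ring_mult: "\<lbrakk>x \<in> residue_ring; y \<in> residue_ring\<rbrakk> \<Longrightarrow> x * y \<in> residue_ring"
    and residue_ideal_diff: "\<lbrakk>x \<in> residue_ideal; y \<in> residue_ideal\<rbrakk> \<Longrightarrow> x - y \<in> residue_ideal"
    and residue_ideal_mult: "\<lbrakk>x \<in> residue_ring; y \<in> residue_ideal\<rbrakk> \<Longrightarrow> x * y \<in> residue_ideal"
    and residue_ring_inverse: "\<lbrakk>x \<in> residue_ring; x \<notin> residue_ideal\<rbrakk> \<Longrightarrow> inverse x \<in> residue_ring"
  using valuation_pair_residue unfolding valuation_pair_def by blast+

lemma residue_ring_0: "0 \<in> residue_ring"
  by (simp add: residue_ideal_0 residue_ideal_subset)

lemma residue_ring_minus: "x \<in> residue_ring \<Longrightarrow> - x \<in> residue_ring"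
  using residue_ring_diff[OF residue_ring_0] by simp

lemma residue_ring_add: "\<lbrakk>x \<in> residue_ring; y \<in> residue_ring\<rbrakk> \<Longrightarrow> x + y \<in> residue_ring"
  using residue_ring_diff[OF _ residue_ring_minus] by fastforce

lemma residue_ideal_minus: "x \<in> residue_ideal \<Longrightarrow> - x \<in> residue_ideal"
  using residue_ideal_diff[OF residue_ideal_0] by simp

lemma residue_ideal_add: "\<lbrakk>x \<in> residue_ideal; y \<in> residue_ideal\<rbrakk> \<Longrightarrow> x + y \<in> residue_ideal"
  using residue_ideal_diff[OF _ residue_ideal_minus] by fastforce

lemma residue_ideal_cong:
  assumes "x - y \<in> residue_ideal"
  shows "x \<in> residue_ideal \<longleftrightarrow> y \<in> residue_ideal"
  using assms residue_ideal_add[of "x - y" y] residue_ideal_diff[of x "x - y"] by auto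

text \<open>A partial equivalence relation, reflexive exactly on \<open>residue_ring\<close>, so
  that the partial quotient is \<open>residue_ring\<close> modulo \<open>residue_ideal\<close> with
  no intermediate subtype.\<close>

definition residue_rel :: "'a::topological_field \<Rightarrow> 'a \<Rightarrow> bool" where
  "residue_rel x y \<longleftrightarrow> x \<in> residue_ring \<and> y \<in> residue_ring \<and> x - y \<in> residue_ideal"

lemma part_equivp_residue_rel: "part_equivp residue_rel"
proof (rule part_equivpI)
  show "\<exists>x. residue_rel x x"
    by (rule exI[of _ 0]) (simp add: residue_rel_def residue_ring_0 residue_ideal_0)
  show "symp residue_rel"
    using residue_ideal_minus by (force simp: symp_def residue_rel_def)
  show "transp residue_rel"
    using residue_ideal_add by (fastforce simp: transp_def residue_rel_def)
qed

quotient_type (overloaded) 'a residue = "'a::topological_field" / partial: residue_rel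
  by (rule part_equivp_residue_rel)

section \<open>Field operations on residue classes\<close>

lemma residue_rel_minus: "residue_rel x y \<Longrightarrow> residue_rel (- x) (- y)"
  using residue_ideal_minus[of "x - y"] by (simp add: residue_rel_def residue_ring_minus)

lemma residue_rel_add: "\<lbrakk>residue_rel x y; residue_rel z w\<rbrakk> \<Longrightarrow> residue_rel (x + z) (y + w)"
  using residue_ideal_add[of "x - y" "z - w"]
  by (simp add: residue_rel_def residue_ring_add algebra_simps)

lemma residue_rel_mult:
  assumes "residue_rel x y" "residue_rel z w"
  shows "residue_rel (x * z) (y * w)"
proof -
  have "x * (z - w) + w * (x - y) \<in> residue_ideal"
    using assms by (auto simp: residue_rel_def intro!: residue_ideal_add residue_ideal_mult)
  then show ?thesis
    using assms by (simp add: residue_rel_def residue_ring_mult algebra_simps)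
qed

lemma residue_rel_inverse:
  assumes "residue_rel x y" "x \<notin> residue_ideal"
  shows "residue_rel (inverse x) (inverse y)"
proof -
  have y: "y \<notin> residue_ideal" "x \<noteq> 0" "y \<noteq> 0"
    using assms residue_ideal_cong[of x y] residue_ideal_0 by (auto simp: residue_rel_def)
  have inv: "inverse x \<in> residue_ring" "inverse y \<in> residue_ring"
    using assms y by (auto simp: residue_rel_def intro: residue_ring_inverse)
  have "(inverse x * inverse y) * - (x - y) \<in> residue_ideal"
    using assms inv by (intro residue_ideal_mult residue_ideal_minus) (auto simp: residue_rel_def residue_ring_mult)
  moreover have "(inverse x * inverse y) * - (x - y) = inverse x - inverse y"
    using y by (simp add: field_simps)
  ultimately show ?thesis using inv by (simp add: residue_rel_def)
qed

instantiation residue :: (topological_field) field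
begin

lift_definition zero_residue :: "'a residue" is 0
  by (simp add: residue_rel_def residue_ring_0 residue_ideal_0)

lift_definition one_residue :: "'a residue" is 1
  by (simp add: residue_rel_def residue_ring_1 residue_ideal_0)

lift_definition plus_residue :: "'a residue \<Rightarrow> 'a residue \<Rightarrow> 'a residue" is "(+)"
  by (rule residue_rel_add)

lift_definition uminus_residue :: "'a residue \<Rightarrow> 'a residue" is uminus
  by (rule residue_rel_minus)

definition minus_residue :: "'a residue \<Rightarrow> 'a residue \<Rightarrow> 'a residue" where
  "minus_residue x y = x + - y"

lift_definition times_residue :: "'a residue \<Rightarrow> 'a residue \<Rightarrow> 'a residue" is "(*)"
  by (rule residue_rel_mult)

text \<open>Elements of the ideal represent the zero class, whose inverse must be zero; their own
  inverses may lie outside the ring.\<close>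

lift_definition inverse_residue :: "'a residue \<Rightarrow> 'a residue"
  is "\<lambda>x. if x \<in> residue_ideal then 0 else inverse x"
  using residue_rel_inverse residue_ideal_cong
  by (auto simp: residue_rel_def residue_ring_0 residue_ideal_0)

definition divide_residue :: "'a residue \<Rightarrow> 'a residue \<Rightarrow> 'a residue" where
  "divide_residue x y = x * inverse y"

lemma residue_rel_refl: "residue_rel x x \<longleftrightarrow> x \<in> residue_ring"
  by (simp add: residue_rel_def residue_ideal_0)

instance
proof
  fix a b c :: "'a residue"
  show "a + b + c = a + (b + c)"
    by transfer (simp add: residue_rel_refl residue_ring_add add.assoc)
  show "a + b = b + a"
    by transfer (simp add: residue_rel_refl residue_ring_add add.commute)
  show "0 + a = a"
    by transfer (simp add: residue_rel_refl)
  show "- a + a = 0"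
    by transfer (simp add: residue_rel_refl residue_ring_0)
  show "a - b = a + - b"
    by (rule minus_residue_def)
  show "a * b * c = a * (b * c)"
    by transfer (simp add: residue_rel_refl residue_ring_mult mult.assoc)
  show "a * b = b * a"
    by transfer (simp add: residue_rel_refl residue_ring_mult mult.commute)
  show "1 * a = a"
    by transfer (simp add: residue_rel_refl)
  show "(a + b) * c = a * c + b * c"
    by transfer (simp add: residue_rel_refl residue_ring_mult residue_ring_add distrib_right)
  show "(0 :: 'a residue) \<noteq> 1"
    by transfer (use residue_ideal_minus residue_ideal_1 in \<open>force simp: residue_rel_def\<close>)
  show "a \<noteq> 0 \<Longrightarrow> inverse a * a = 1"
  proof transfer
    fix a :: 'a assume a: "residue_rel a a" "\<not> residue_rel a 0"
    then have "a \<notin> residue_ideal" by (auto simp: residue_rel_def residue_ring_0)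
    moreover from this have "a \<noteq> 0" using residue_ideal_0 by blast
    ultimately show "residue_rel ((if a \<in> residue_ideal then 0 else inverse a) * a) 1"
      by (simp add: residue_rel_refl residue_ring_1)
  qed
  show "a div b = a * inverse b"
    by (rule divide_residue_def)
  show "inverse (0 :: 'a residue) = 0"
    by transfer (simp add: residue_rel_refl residue_ring_0 residue_ideal_0)
qed

end

section \<open>The reduction homomorphism, extended by 0 outside the valuation ring\<close>

lift_definition to_residue :: "'a::topological_field \<Rightarrow> 'a residue"
  is "\<lambda>x. if x \<in> residue_ring then x else 0"
  by (simp add: residue_rel_refl residue_ring_0)

lemma to_residue_add:
  "\<lbrakk>x \<in> residue_ring; y \<in> residue_ring\<rbrakk> \<Longrightarrow> to_residue (x + y) = to_residue x + to_residue y"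
  by transfer (simp add: residue_rel_refl residue_ring_add)

lemma to_residue_mult:
  "\<lbrakk>x \<in> residue_ring; y \<in> residue_ring\<rbrakk> \<Longrightarrow> to_residue (x * y) = to_residue x * to_residue y"
  by transfer (simp add: residue_rel_refl residue_ring_mult)

lemma to_residue_0: "to_residue 0 = 0"
  by transfer (simp add: residue_rel_refl residue_ring_0)

lemma to_residue_1: "to_residue 1 = 1"
  by transfer (simp add: residue_rel_refl residue_ring_1)

lemma to_residue_eq_iff:
  "\<lbrakk>x \<in> residue_ring; y \<in> residue_ring\<rbrakk> \<Longrightarrow> to_residue x = to_residue y \<longleftrightarrow> x - y \<in> residue_ideal"
  by transfer (simp add: residue_rel_def)

lemma to_residue_eq_0_iff: "x \<in> residue_ring \<Longrightarrow> to_residue x = 0 \<longleftrightarrow> x \<in> residue_ideal"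
  using to_residue_eq_iff[OF _ residue_ring_0] by (simp add: to_residue_0)

lemma to_residue_surj: "\<exists>x\<in>residue_ring. to_residue x = y"
proof transfer
  fix y :: 'a assume "residue_rel y y"
  then show "\<exists>x\<in>residue_ring. residue_rel (if x \<in> residue_ring then x else 0) y"
    by (intro bexI[of _ y]) (auto simp: residue_rel_refl)
qed

lemma residue_ring_power: "x \<in> residue_ring \<Longrightarrow> x ^ n \<in> residue_ring"
  by (induction n) (simp_all add: residue_ring_1 residue_ring_mult)

lemma to_residue_power: "x \<in> residue_ring \<Longrightarrow> to_residue (x ^ n) = to_residue x ^ n"
  by (induction n) (simp_all add: to_residue_1 to_residue_mult residue_ring_power)

lemma to_residue_prod:
  assumes "\<And>i. i \<in> I \<Longrightarrow> f i \<in> residue_ring"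
  shows "(\<Prod>i\<in>I. f i) \<in> residue_ring \<and> to_residue (\<Prod>i\<in>I. f i) = (\<Prod>i\<in>I. to_residue (f i))"
  using assms
  by (induction I rule: infinite_finite_induct)
     (auto simp: residue_ring_1 to_residue_1 residue_ring_mult to_residue_mult)

lemma to_residue_sum:
  assumes "\<And>i. i \<in> I \<Longrightarrow> f i \<in> residue_ring"
  shows "(\<Sum>i\<in>I. f i) \<in> residue_ring \<and> to_residue (\<Sum>i\<in>I. f i) = (\<Sum>i\<in>I. to_residue (f i))"
  using assms
  by (induction I rule: infinite_finite_induct)
     (auto simp: residue_ring_0 to_residue_0 residue_ring_add to_residue_add)

subsection \<open>Anisotropic forms over finite fields\<close>

text \<open>Multiplication by a nonzero x permutes the nonzero elements; comparing the products of
  all of them shows that x to the power q - 1 is 1.\<close>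

lemma finite_field_power_card:
  fixes x :: "'f::field"
  assumes "finite (UNIV :: 'f set)"
  shows "x ^ CARD('f) = x"
proof (cases "x = 0")
  case True
  have "0 < CARD('f)"
    using assms by (rule finite_UNIV_card_ge_0)
  then show ?thesis by (simp only: True zero_power)
next
  case False
  let ?U = "UNIV - {0 :: 'f}"
  have "bij_betw ((*) x) ?U ?U"
    by (rule bij_betw_byWitness[of _ "\<lambda>y. y / x"]) (use False in auto)
  then have "(\<Prod>y\<in>?U. x * y) = \<Prod>?U"
    by (rule prod.reindex_bij_betw)
  then have "x ^ card ?U * \<Prod>?U = 1 * \<Prod>?U"
    by (simp only: prod.distrib prod_constant mult_1_left)
  moreover have "\<Prod>?U \<noteq> 0"
    using assms by simp
  ultimately have "x ^ card ?U = 1"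
    using mult_right_cancel by blast
  moreover have "CARD('f) = Suc (card ?U)"
    using card_Suc_Diff1[OF assms UNIV_I[of 0]] by (rule sym)
  ultimately show ?thesis by (simp only: power_Suc mult_1_right)
qed

section \<open>The Frobenius map on the algebraic closure of a finite field\<close>

context
  fixes q :: nat and F :: "'f::field alg_closure set"
  assumes finite_UNIV: "finite (UNIV :: 'f set)"
  defines "q \<equiv> CARD('f)" and "F \<equiv> range to_ac"
begin

lemma card_gt_1: "1 < q"
proof -
  have "card {0, 1 :: 'f} \<le> q"
    unfolding q_def using finite_UNIV by (intro card_mono) auto
  then show ?thesis by simp
qed

lemma card_range_to_ac: "card F = q"
  unfolding F_def q_def by (rule card_image[OF inj_to_ac])

lemma to_ac_power_card: "to_ac (x :: 'f) ^ (q ^ n) = to_ac x"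
proof (induction n)
  case (Suc n)
  have "to_ac x ^ (q ^ Suc n) = (to_ac x ^ (q ^ n)) ^ q"
    by (simp add: power_mult[symmetric] mult.commute)
  also have "\<dots> = to_ac (x ^ q)" by (simp add: Suc)
  also have "x ^ q = x" unfolding q_def by (rule finite_field_power_card[OF finite_UNIV])
  finally show ?case .
qed simp

text \<open>The q elements of \<open>F\<close> are roots of X^q - X, which has at most q roots, so
  there are no others.\<close>

lemma frobenius_fixed_in_range:
  assumes "z ^ q = z"
  shows "z \<in> F"
proof -
  define p :: "'f alg_closure poly" where "p = Polynomial.monom 1 q - Polynomial.monom 1 1"
  have p: "p \<noteq> 0" "Polynomial.degree p \<le> q"
    unfolding p_def using card_gt_1 by (auto simp: monom_eq_iff' intro!: degree_diff_le order.trans[OF degree_monom_le])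
  have poly: "poly p x = 0 \<longleftrightarrow> x ^ q = x" for x
    by (simp add: p_def poly_monom)
  have "F \<subseteq> {x. poly p x = 0}"
    using to_ac_power_card[of _ 1] by (auto simp: F_def poly)
  moreover have "card {x. poly p x = 0} \<le> card F"
    using card_poly_roots_bound[of p] p by (simp add: card_range_to_ac)
  ultimately have "F = {x. poly p x = 0}"
    using poly_roots_finite[OF p(1)] by (intro card_seteq) auto
  then show ?thesis using assms by (simp add: poly)
qed

text \<open>For fixed \<open>x\<close> both sides differ, as polynomials in \<open>y\<close>, by less than degree \<open>q\<close>, so it
  suffices to know the identity for the \<open>q\<close> values \<open>y \<in> F\<close>.\<close>
lemma frobenius_add_aux:
  fixes x :: "'f alg_closure"
  assumes "\<And>y. y \<in> F \<Longrightarrow> (x + y) ^ q = x ^ q + y ^ q"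
  shows "(x + y) ^ q = x ^ q + y ^ q"
proof -
  define p where "p = [:x, 1:] ^ q - Polynomial.monom 1 q"
  have "Polynomial.degree p \<le> q"
    unfolding p_def by (intro degree_diff_le degree_monom_le) (simp add: degree_linear_power)
  moreover have "Polynomial.coeff p q = 0"
    using lead_coeff_power[of "[:x, 1:]" q] by (simp add: p_def degree_linear_power)
  ultimately have deg: "Polynomial.degree p < q"
    using card_gt_1 by (metis leading_coeff_0_iff degree_0 le_neq_implies_less less_imp_le_nat not_one_less_zero gr0I)
  have "p = [:x ^ q:]"
    by (rule poly_eqI_degree[of F])
       (use assms deg card_gt_1 in \<open>auto simp: p_def poly_monom card_range_to_ac\<close>)
  then have "poly p y = x ^ q" by simp
  then show ?thesis by (simp add: p_def poly_monom algebra_simps)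
qed

text \<open>On \<open>F\<close> the map is the identity and hence additive. Two applications of
  \<open>frobenius_add_aux\<close> free first one argument and then the other from lying in
  \<open>F\<close>.\<close>

lemma frobenius_add: "(x + y) ^ q = x ^ q + (y :: 'f alg_closure) ^ q"
proof (rule frobenius_add_aux)
  fix y :: "'f alg_closure" assume y: "y \<in> F"
  have "(y + x) ^ q = y ^ q + x ^ q"
  proof (rule frobenius_add_aux)
    fix z assume "z \<in> F"
    with y obtain a b where ab: "y = to_ac a" "z = to_ac b" by (auto simp: F_def)
    have "to_ac (a + b) ^ q = to_ac a ^ q + to_ac b ^ q"
      using to_ac_power_card[of a 1] to_ac_power_card[of b 1] to_ac_power_card[of "a + b" 1] by simp
    then show "(y + z) ^ q = y ^ q + z ^ q" by (simp add: ab)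
  qed
  then show "(x + y) ^ q = x ^ q + y ^ q" by (simp add: add.commute)
qed

lemma frobenius_sum: "(\<Sum>i\<in>I. f i) ^ (q ^ n) = (\<Sum>i\<in>I. (f i :: 'f alg_closure) ^ (q ^ n))"
proof -
  have 1: "(\<Sum>i\<in>I. g i) ^ q = (\<Sum>i\<in>I. (g i :: 'f alg_closure) ^ q)" for g
    using card_gt_1
    by (induction I rule: infinite_finite_induct) (auto simp: frobenius_add power_0_left)
  show ?thesis
  proof (induction n)
    case (Suc n)
    have "(\<Sum>i\<in>I. f i) ^ (q ^ Suc n) = ((\<Sum>i\<in>I. f i) ^ (q ^ n)) ^ q"
      by (simp add: power_mult[symmetric] mult.commute)
    also have "\<dots> = (\<Sum>i\<in>I. f i ^ (q ^ n)) ^ q" by (simp add: Suc)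
    also have "\<dots> = (\<Sum>i\<in>I. f i ^ (q ^ Suc n))"
      unfolding 1 by (simp add: power_mult[symmetric] mult.commute)
    finally show ?case .
  qed simp
qed

section \<open>Fixed points of a power of the Frobenius map\<close>

lemma poly_pderiv_double_root:
  "poly (pderiv ([:- x, 1:] * ([:- x, 1:] * p))) x = (0 :: 'f alg_closure)"
  by (simp only: pderiv_mult poly_add poly_mult) simp

text \<open>The polynomial X^(q^r) - X splits, and its derivative is -1 because q vanishes in the
  field. A repeated root would be a root of the derivative, so the roots are distinct.\<close>

lemma ex_fixed_points:
  assumes "0 < r"
  shows "\<exists>S :: 'f alg_closure set. finite S \<and> q ^ r \<le> card S \<and> (\<forall>x\<in>S. x ^ (q ^ r) = x)"
proof -
  have qr: "1 < q ^ r"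
    using assms card_gt_1 by (intro one_less_power) auto
  define p :: "'f alg_closure poly" where "p = Polynomial.monom 1 (q ^ r) + Polynomial.monom (- 1) 1"
  have deg: "Polynomial.degree p = q ^ r"
    unfolding p_def using qr by (subst degree_add_eq_left) (auto simp: degree_monom_eq)
  have "of_nat q = (0 :: 'f alg_closure)"
    using CHAR_dvd_CARD[where 'a = 'f] by (simp add: of_nat_eq_0_iff_char_dvd q_def)
  then have pderiv: "pderiv p = - 1"
    using assms by (simp add: p_def pderiv_add pderiv_monom power_0_left monom_0 one_pCons)
  obtain R where R: "size R = Polynomial.degree p" "p = Polynomial.smult (Polynomial.lead_coeff p) (\<Prod>x\<in>#R. [:-x, 1:])"
    using alg_closed_imp_factorization[of p] deg qr by fastforce
  have count: "count R x \<le> 1" for x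
  proof (rule ccontr)
    assume "\<not> count R x \<le> 1"
    then have "replicate_mset 2 x \<subseteq># R"
      by (simp flip: count_le_replicate_mset_subset_eq)
    then obtain T where "R = add_mset x (add_mset x T)"
      by (auto simp: numeral_2_eq_2 mset_subset_eq_exists_conv)
    then have "p = [:-x, 1:] * ([:-x, 1:] * Polynomial.smult (Polynomial.lead_coeff p) (\<Prod>x\<in>#T. [:-x, 1:]))"
      using R(2) by (simp del: mult_pCons_left)
    then have "poly (pderiv p) x = 0"
      by (metis poly_pderiv_double_root)
    then show False by (simp add: pderiv)
  qed
  have "q ^ r = (\<Sum>x\<in>set_mset R. count R x)"
    using R(1) deg by (simp add: size_multiset_overloaded_eq)
  also have "\<dots> \<le> card (set_mset R)"
    using sum_bounded_above[of "set_mset R" "count R" 1] count by simp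
  finally have "q ^ r \<le> card (set_mset R)" .
  moreover have "x ^ (q ^ r) = x" if "x \<in># R" for x
  proof -
    have "poly p x = 0"
      using that by (subst R(2)) (auto simp: poly_prod_mset prod_mset_zero_iff)
    then show ?thesis by (simp add: p_def poly_monom)
  qed
  ultimately show ?thesis by (intro exI[of _ "set_mset R"]) simp
qed

text \<open>A basis over \<open>F\<close> of the field with q^r elements, built one vector at a
  time: the span of s < r vectors has at most q^s < q^r elements and so misses some fixed
  point.\<close>

lemma ex_independent_fixed_points:
  assumes "0 < r" "s \<le> r"
  shows "\<exists>e :: nat \<Rightarrow> 'f alg_closure. (\<forall>j<s. e j ^ (q ^ r) = e j) \<and>
           (\<forall>y. (\<Sum>j<s. to_ac (y j) * e j) = 0 \<longrightarrow> (\<forall>j<s. y j = 0))"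
  using assms(2)
proof (induction s)
  case (Suc s)
  then obtain e :: "nat \<Rightarrow> 'f alg_closure"
    where e: "\<And>j. j < s \<Longrightarrow> e j ^ (q ^ r) = e j"
      and indep: "\<And>y j. (\<Sum>j<s. to_ac (y j) * e j) = 0 \<Longrightarrow> j < s \<Longrightarrow> y j = 0"
    by auto
  obtain S :: "'f alg_closure set"
    where S: "finite S" "q ^ r \<le> card S" "\<And>x. x \<in> S \<Longrightarrow> x ^ (q ^ r) = x"
    using ex_fixed_points[OF assms(1)] by blast
  define T where "T = (\<lambda>y. \<Sum>j<s. to_ac (y j) * e j) ` (PiE {..<s} (\<lambda>_. UNIV :: 'f set))"
  have fin: "finite (PiE {..<s} (\<lambda>_. UNIV :: 'f set))"
    using finite_UNIV by (intro finite_PiE) auto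
  have "card T \<le> q ^ s"
    unfolding T_def using card_image_le[OF fin] by (simp add: card_PiE q_def)
  also have "\<dots> < q ^ r"
    using Suc.prems card_gt_1 by (intro power_strict_increasing) auto
  finally have "\<not> S \<subseteq> T"
    using S(2) card_mono[of T S] fin by (auto simp: T_def)
  then obtain z where z: "z \<in> S" "z \<notin> T" by blast
  \<comment> \<open>Only functions extensional on the index set were counted in \<open>T\<close>;
    restricting an arbitrary \<open>y\<close> leaves the combination unchanged.\<close>
  have span: "(\<Sum>j<s. to_ac (y j) * e j) \<in> T" for y
    unfolding T_def by (intro image_eqI[of _ _ "restrict y {..<s}"]) auto
  show ?case
  proof (intro exI conjI allI impI)
    fix j assume "j < Suc s"
    then show "(e(s := z)) j ^ (q ^ r) = (e(s := z)) j"
      using e S(3) z by (auto simp: less_Suc_eq)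
  next
    fix y j assume y: "(\<Sum>j<Suc s. to_ac (y j) * (e(s := z)) j) = 0" and j: "j < Suc s"
    then have sum: "(\<Sum>j<s. to_ac (y j) * e j) + to_ac (y s) * z = 0" by simp
    have "y s = 0"
    proof (rule ccontr)
      assume "y s \<noteq> 0"
      then have "z = (\<Sum>j<s. to_ac (- y j / y s) * e j)"
        using sum by (simp add: sum_negf sum_divide_distrib[symmetric] field_simps add_eq_0_iff)
      with z(2) show False using span[of "\<lambda>j. - y j / y s"] by simp
    qed
    then show "y j = 0"
      using sum indep j by (auto simp: less_Suc_eq)
  qed
qed simp

end

text \<open>The norm form of the extension of degree \<open>r\<close>: its coefficients are symmetric under cyclic shifts of the
  \<open>r\<close> factors and therefore fixed by the Frobenius map.\<close>
theorem anisotropic_form: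
  fixes r :: nat
  assumes fin: "finite (UNIV :: 'f set)" and r: "0 < r"
  shows "\<exists>A (c :: (nat \<Rightarrow> nat) \<Rightarrow> 'f::field). (\<forall>\<alpha>\<in>A. (\<Sum>j<r. \<alpha> j) = r) \<and>
    (\<forall>y. (\<Sum>\<alpha>\<in>A. c \<alpha> * (\<Prod>j<r. y j ^ \<alpha> j)) = 0 \<longrightarrow> (\<forall>j<r. y j = 0))"
proof -
  define q where "q = CARD('f)"
  note frob_sum = frobenius_sum[OF fin, folded q_def]
  note to_ac_pow = to_ac_power_card[OF fin, folded q_def]
  obtain e :: "nat \<Rightarrow> 'f alg_closure"
    where e: "\<And>j. j < r \<Longrightarrow> e j ^ (q ^ r) = e j"
      and indep: "\<And>y. (\<Sum>j<r. to_ac (y j) * e j) = 0 \<Longrightarrow> \<forall>j<r. y j = 0"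
    using ex_independent_fixed_points[OF fin r order.refl, folded q_def] by blast
  \<comment> \<open>These expand the product over t of the sums of
    \<open>y j * e j ^ (q ^ t)\<close>: \<beta> in \<open>P\<close> selects one summand from each
    factor, \<open>type \<beta>\<close> is the exponent vector of the resulting monomial, and
    \<open>d \<alpha>\<close> collects the coefficient of the monomial with exponents
    \<alpha>.\<close>
  define P where "P = PiE {..<r} (\<lambda>_. {..<r})"
  define type where "type = (\<lambda>\<beta> j. card {t \<in> {..<r}. \<beta> t = (j :: nat)})"
  define d where "d \<alpha> = (\<Sum>\<beta>\<in>{\<beta>\<in>P. type \<beta> = \<alpha>}. \<Prod>t<r. e (\<beta> t) ^ (q ^ t))" for \<alpha>
  have finP: "finite P" unfolding P_def by (intro finite_PiE) auto
  have P: "\<beta> t < r" if "\<beta> \<in> P" "t < r" for \<beta> t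
    using that by (auto simp: P_def)
  \<comment> \<open>Mutually inverse cyclic shifts of the r factors.\<close>
  define \<sigma> where "\<sigma> t = (if Suc t = r then 0 else Suc t)" for t
  define \<tau> where "\<tau> t = (if t = 0 then r - 1 else t - 1)" for t
  have \<sigma>\<tau>: "\<sigma> t < r" "\<tau> t < r" "\<sigma> (\<tau> t) = t" "\<tau> (\<sigma> t) = t" if "t < r" for t
    using that by (auto simp: \<sigma>_def \<tau>_def)
  define shift where "shift f \<beta> = restrict (\<lambda>t. \<beta> (f t)) {..<r}" for f and \<beta> :: "nat \<Rightarrow> nat"
  have shift_type: "type (shift f \<beta>) = type \<beta>"
    if fg: "\<And>t. t < r \<Longrightarrow> f t < r" "\<And>t. t < r \<Longrightarrow> g t < r"
      "\<And>t. t < r \<Longrightarrow> f (g t) = t" "\<And>t. t < r \<Longrightarrow> g (f t) = t" for f g \<beta>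
  proof
    fix j
    have "bij_betw f {t \<in> {..<r}. shift f \<beta> t = j} {t \<in> {..<r}. \<beta> t = j}"
      by (rule bij_betw_byWitness[of _ g]) (use fg in \<open>auto simp: shift_def\<close>)
    then show "type (shift f \<beta>) j = type \<beta> j"
      unfolding type_def by (rule bij_betw_same_card)
  qed
  have shift_P: "shift \<sigma> \<beta> \<in> P" "shift \<tau> \<beta> \<in> P" if "\<beta> \<in> P" for \<beta>
    using P[OF that] \<sigma>\<tau> by (auto simp: P_def shift_def)
  have shift_shift: "shift \<tau> (shift \<sigma> \<beta>) = \<beta>" "shift \<sigma> (shift \<tau> \<beta>) = \<beta>" if "\<beta> \<in> P" for \<beta>
    using that \<sigma>\<tau> by (auto simp: P_def shift_def PiE_def extensional_def fun_eq_iff)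
  have shift_prod: "(\<Prod>t<r. e (shift \<tau> \<beta> t) ^ (q ^ t)) = (\<Prod>t<r. e (\<beta> t) ^ (q ^ Suc t))"
    if "\<beta> \<in> P" for \<beta>
  proof (rule prod.reindex_bij_witness[of _ \<sigma> \<tau>])
    fix t assume t: "t \<in> {..<r}"
    show "e (\<beta> (\<tau> t)) ^ (q ^ Suc (\<tau> t)) = e (shift \<tau> \<beta> t) ^ (q ^ t)"
    \<comment> \<open>At t = 0 the shift wraps around to r - 1, where the exponent is q^r; this
      power fixes the \<open>e j\<close>.\<close>
    proof (cases "t = 0")
      case True
      then show ?thesis
        using e[OF P[OF that, of "r - 1"]] r by (simp add: shift_def \<tau>_def flip: power_Suc)
    next
      case False
      then show ?thesis using t by (simp add: shift_def \<tau>_def flip: power_Suc)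
    qed
  qed (use \<sigma>\<tau> in auto)
  \<comment> \<open>The q-th power moves each factor to the next exponent, which a cyclic shift of
    \<beta> undoes. Shifts preserve the type, so they only permute the summands of
    \<open>d \<alpha>\<close>.\<close>
  have "d \<alpha> ^ q = d \<alpha>" for \<alpha>
  proof -
    have "d \<alpha> ^ q = (\<Sum>\<beta>\<in>{\<beta>\<in>P. type \<beta> = \<alpha>}. \<Prod>t<r. e (\<beta> t) ^ (q ^ Suc t))"
      unfolding d_def
      by (simp add: frob_sum[of _ _ 1, simplified] prod_power_distrib mult.commute flip: power_mult)
    also have "\<dots> = d \<alpha>"
      unfolding d_def
      by (rule sum.reindex_bij_witness[where i = "shift \<sigma>" and j = "shift \<tau>"])
         (use shift_type[of \<sigma> \<tau>] shift_type[of \<tau> \<sigma>] \<sigma>\<tau> in \<open>simp_all add: shift_P shift_shift shift_prod\<close>)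
    finally show ?thesis .
  qed
  then have "\<exists>c. to_ac c = d \<alpha>" for \<alpha>
    using frobenius_fixed_in_range[OF fin, folded q_def] by (metis rangeE)
  then obtain c where c: "\<And>\<alpha>. to_ac (c \<alpha>) = d \<alpha>" by metis
  show ?thesis
  proof (intro exI conjI)
    show "\<forall>\<alpha>\<in>type ` P. (\<Sum>j<r. \<alpha> j) = r"
    proof
      fix \<alpha> assume "\<alpha> \<in> type ` P"
      then obtain \<beta> where \<beta>: "\<beta> \<in> P" "\<alpha> = type \<beta>" by blast
      have "(\<Sum>j<r. \<Sum>t\<in>{t \<in> {..<r}. \<beta> t = j}. 1 :: nat) = (\<Sum>t<r. 1)"
        by (rule sum.group) (use \<beta> P in auto)
      then show "(\<Sum>j<r. \<alpha> j) = r" by (simp add: \<beta> type_def)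
    qed
    show "\<forall>y. (\<Sum>\<alpha>\<in>type ` P. c \<alpha> * (\<Prod>j<r. y j ^ \<alpha> j)) = 0 \<longrightarrow> (\<forall>j<r. y j = 0)"
    proof (rule allI, rule impI)
      fix y :: "nat \<Rightarrow> 'f" assume y: "(\<Sum>\<alpha>\<in>type ` P. c \<alpha> * (\<Prod>j<r. y j ^ \<alpha> j)) = 0"
      have prod_type: "(\<Prod>j<r. to_ac (y j) ^ type \<beta> j) = (\<Prod>t<r. to_ac (y (\<beta> t)))" if "\<beta> \<in> P" for \<beta>
      proof -
        have "(\<Prod>t<r. to_ac (y (\<beta> t))) = (\<Prod>j<r. \<Prod>t\<in>{t \<in> {..<r}. \<beta> t = j}. to_ac (y (\<beta> t)))"
          by (rule prod.group[symmetric]) (use that P in auto)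
        also have "\<dots> = (\<Prod>j<r. to_ac (y j) ^ type \<beta> j)"
          by (simp add: type_def)
        finally show ?thesis ..
      qed
      \<comment> \<open>The left side is the norm of the element with coordinates \<open>y\<close>.
        Frobenius fixes the coordinates and acts on the \<open>e j\<close> only.\<close>
      have "(\<Prod>t<r. (\<Sum>j<r. to_ac (y j) * e j) ^ (q ^ t)) = (\<Prod>t<r. \<Sum>j<r. to_ac (y j) * e j ^ (q ^ t))"
        by (simp add: frob_sum power_mult_distrib to_ac_pow)
      also have "\<dots> = (\<Sum>\<beta>\<in>P. \<Prod>t<r. to_ac (y (\<beta> t)) * e (\<beta> t) ^ (q ^ t))"
        unfolding P_def by (rule prod_sum_PiE) auto
      also have "\<dots> = (\<Sum>\<beta>\<in>P. (\<Prod>j<r. to_ac (y j) ^ type \<beta> j) * (\<Prod>t<r. e (\<beta> t) ^ (q ^ t)))"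
        by (intro sum.cong) (simp_all add: prod_type prod.distrib)
      also have "\<dots> = (\<Sum>\<alpha>\<in>type ` P. \<Sum>\<beta>\<in>{\<beta>\<in>P. type \<beta> = \<alpha>}.
          (\<Prod>j<r. to_ac (y j) ^ type \<beta> j) * (\<Prod>t<r. e (\<beta> t) ^ (q ^ t)))"
        using finP by (intro sum.group[symmetric]) auto
      also have "\<dots> = (\<Sum>\<alpha>\<in>type ` P. (\<Prod>j<r. to_ac (y j) ^ \<alpha> j) * d \<alpha>)"
        by (simp add: d_def sum_distrib_left)
      also have "\<dots> = to_ac (\<Sum>\<alpha>\<in>type ` P. c \<alpha> * (\<Prod>j<r. y j ^ \<alpha> j))"
        by (simp add: c to_ac_sum to_ac_prod mult.commute)
      finally have "(\<Sum>j<r. to_ac (y j) * e j) = 0"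
        using y by (simp add: prod_zero_iff)
      then show "\<forall>j<r. y j = 0" by (rule indep)
    qed
  qed
qed

subsection \<open>Homogeneous polynomials\<close>

definition multi_indices :: "'b set \<Rightarrow> nat \<Rightarrow> ('b \<Rightarrow> nat) set" where
  "multi_indices B r = {\<alpha>. (\<forall>b. b \<notin> B \<longrightarrow> \<alpha> b = 0) \<and> (\<Sum>b\<in>B. \<alpha> b) = r}"

lemma finite_multi_indices:
  assumes "finite B"
  shows "finite (multi_indices B r)"
proof (rule finite_subset)
  show "multi_indices B r \<subseteq> {\<alpha>. \<forall>b. (b \<in> B \<longrightarrow> \<alpha> b \<in> {..r}) \<and> (b \<notin> B \<longrightarrow> \<alpha> b = 0)}"
    using member_le_sum[OF _ _ assms] by (fastforce simp: multi_indices_def)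
  show "finite {\<alpha>. \<forall>b. (b \<in> B \<longrightarrow> \<alpha> b \<in> {..r}) \<and> (b \<notin> B \<longrightarrow> \<alpha> b = 0)}"
    using assms by (intro finite_set_of_finite_funs) auto
qed

lemma multi_indices_0:
  assumes "finite B" "\<alpha> \<in> multi_indices B 0"
  shows "(\<Prod>b\<in>B. z b ^ \<alpha> b) = (1 :: 'k::field)"
  using assms by (simp add: multi_indices_def)

text \<open>Lowers one positive exponent by 1. The variable p and the remaining exponents depend on
  \<alpha> alone, so the factorization is uniform in z.\<close>

lemma multi_indices_Suc:
  assumes "finite B" "\<alpha> \<in> multi_indices B (Suc n)"
  obtains p \<beta> where "p \<in> B" "\<beta> \<in> multi_indices B n"
    "\<And>z :: 'b \<Rightarrow> 'k::field. (\<Prod>b\<in>B. z b ^ \<alpha> b) = z p * (\<Prod>b\<in>B. z b ^ \<beta> b)"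
proof -
  have \<alpha>: "\<And>b. b \<notin> B \<Longrightarrow> \<alpha> b = 0" "(\<Sum>b\<in>B. \<alpha> b) = Suc n"
    using assms(2) by (auto simp: multi_indices_def)
  then obtain p where p: "p \<in> B" "\<alpha> p \<noteq> 0"
    by (metis sum.neutral nat.distinct(1))
  define \<beta> where "\<beta> = \<alpha>(p := \<alpha> p - 1)"
  have "(\<Sum>b\<in>B. \<alpha> b) = \<alpha> p + (\<Sum>b\<in>B - {p}. \<alpha> b)" "(\<Sum>b\<in>B. \<beta> b) = \<beta> p + (\<Sum>b\<in>B - {p}. \<beta> b)"
    using p(1) assms(1) by (auto intro: sum.remove)
  moreover have "(\<Sum>b\<in>B - {p}. \<beta> b) = (\<Sum>b\<in>B - {p}. \<alpha> b)"
    by (intro sum.cong) (auto simp: \<beta>_def)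
  ultimately have "\<beta> \<in> multi_indices B n"
    using p \<alpha> by (auto simp: multi_indices_def \<beta>_def)
  moreover have "(\<Prod>b\<in>B. z b ^ \<alpha> b) = z p * (\<Prod>b\<in>B. z b ^ \<beta> b)" for z :: "'b \<Rightarrow> 'k"
  proof -
    have "(\<Prod>b\<in>B. z b ^ \<alpha> b) = z p ^ \<alpha> p * (\<Prod>b\<in>B - {p}. z b ^ \<alpha> b)"
      using p(1) assms(1) by (rule prod.remove[rotated])
    also have "z p ^ \<alpha> p = z p * z p ^ \<beta> p"
      using p(2) by (simp add: \<beta>_def flip: power_Suc)
    also have "(\<Prod>b\<in>B - {p}. z b ^ \<alpha> b) = (\<Prod>b\<in>B - {p}. z b ^ \<beta> b)"
      by (intro prod.cong) (auto simp: \<beta>_def)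
    also have "z p * z p ^ \<beta> p * (\<Prod>b\<in>B - {p}. z b ^ \<beta> b) = z p * (\<Prod>b\<in>B. z b ^ \<beta> b)"
      using prod.remove[OF assms(1) p(1), of "\<lambda>b. z b ^ \<beta> b"] by (simp add: mult.assoc)
    finally show ?thesis .
  qed
  ultimately show ?thesis using that p(1) by blast
qed

text \<open>With each monomial a product of two (possibly equal) coordinates, polarizing a quadratic
  form becomes a termwise computation.\<close>

lemma quadratic_monomial:
  assumes "finite B" "\<alpha> \<in> multi_indices B 2"
  shows "\<exists>p q. \<forall>z :: 'b \<Rightarrow> 'k::field. (\<Prod>b\<in>B. z b ^ \<alpha> b) = z p * z q"
proof -
  obtain p \<beta> where \<beta>: "\<beta> \<in> multi_indices B (Suc 0)"
    "\<And>z :: 'b \<Rightarrow> 'k. (\<Prod>b\<in>B. z b ^ \<alpha> b) = z p * (\<Prod>b\<in>B. z b ^ \<beta> b)"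
    using multi_indices_Suc[OF assms(1), of \<alpha> "Suc 0"] assms(2) unfolding numeral_2_eq_2 by metis
  obtain q \<gamma> where \<gamma>: "\<gamma> \<in> multi_indices B 0"
    "\<And>z :: 'b \<Rightarrow> 'k. (\<Prod>b\<in>B. z b ^ \<beta> b) = z q * (\<Prod>b\<in>B. z b ^ \<gamma> b)"
    using multi_indices_Suc[OF assms(1) \<beta>(1)] by metis
  show ?thesis
    using \<beta>(2) \<gamma>(2) multi_indices_0[OF assms(1) \<gamma>(1)] by (metis mult_1_right)
qed

section \<open>Closure properties of homogeneous polynomials\<close>

context
  fixes smul :: "'k::field \<Rightarrow> 'v::ab_group_add \<Rightarrow> 'v" and B :: "'v set"
  assumes finite_B: "finite B"
begin

lemma homogeneous_polynomial_altdef: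
  "homogeneous_polynomial smul B r \<nu> \<longleftrightarrow>
     (\<exists>c. \<forall>x. \<nu> x = (\<Sum>\<alpha>\<in>multi_indices B r. c \<alpha> * (\<Prod>b\<in>B. module.representation smul B x b ^ \<alpha> b)))"
  unfolding homogeneous_polynomial_def multi_indices_def ..

lemma homogeneous_polynomial_sum:
  assumes "\<And>i. i \<in> I \<Longrightarrow> homogeneous_polynomial smul B r (f i)"
  shows "homogeneous_polynomial smul B r (\<lambda>x. \<Sum>i\<in>I. a i * f i x)"
proof -
  obtain c where c: "\<And>i x. i \<in> I \<Longrightarrow>
      f i x = (\<Sum>\<alpha>\<in>multi_indices B r. c i \<alpha> * (\<Prod>b\<in>B. module.representation smul B x b ^ \<alpha> b))"
    using assms unfolding homogeneous_polynomial_altdef by metis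
  have "(\<Sum>i\<in>I. a i * f i x) = (\<Sum>\<alpha>\<in>multi_indices B r.
      (\<Sum>i\<in>I. a i * c i \<alpha>) * (\<Prod>b\<in>B. module.representation smul B x b ^ \<alpha> b))" for x
    by (simp add: c sum_distrib_left sum_distrib_right mult.assoc) (rule sum.swap)
  then show ?thesis unfolding homogeneous_polynomial_altdef
    by (intro exI[of _ "\<lambda>\<alpha>. \<Sum>i\<in>I. a i * c i \<alpha>"]) simp
qed

lemma homogeneous_polynomial_monomial:
  assumes "\<alpha> \<in> multi_indices B r"
  shows "homogeneous_polynomial smul B r (\<lambda>x. \<Prod>b\<in>B. module.representation smul B x b ^ \<alpha> b)"
  unfolding homogeneous_polynomial_altdef
  using assms finite_multi_indices[OF finite_B]
  by (intro exI[of _ "\<lambda>\<beta>. if \<beta> = \<alpha> then 1 else 0"]) (simp add: if_distrib if_distribR sum.delta cong: if_cong)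

lemma homogeneous_polynomial_0: "homogeneous_polynomial smul B r (\<lambda>x. 0)"
  using homogeneous_polynomial_sum[of "{}"] by simp

lemma homogeneous_polynomial_mult:
  assumes "homogeneous_polynomial smul B r f" "homogeneous_polynomial smul B s g"
  shows "homogeneous_polynomial smul B (r + s) (\<lambda>x. f x * g x)"
proof -
  let ?m = "\<lambda>x \<alpha>. \<Prod>b\<in>B. module.representation smul B x b ^ \<alpha> b"
  obtain c where c: "\<And>x. f x = (\<Sum>\<alpha>\<in>multi_indices B r. c \<alpha> * ?m x \<alpha>)"
    using assms(1) unfolding homogeneous_polynomial_altdef by blast
  obtain d where d: "\<And>x. g x = (\<Sum>\<beta>\<in>multi_indices B s. d \<beta> * ?m x \<beta>)"
    using assms(2) unfolding homogeneous_polynomial_altdef by blast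
  \<comment> \<open>Different pairs of exponent vectors may have the same sum. Indexing by pairs, as
    a linear combination of monomials, avoids collecting equal ones.\<close>
  have "homogeneous_polynomial smul B (r + s)
      (\<lambda>x. \<Sum>(\<alpha>, \<beta>)\<in>multi_indices B r \<times> multi_indices B s. c \<alpha> * d \<beta> * ?m x (\<lambda>b. \<alpha> b + \<beta> b))"
    unfolding split_def
  proof (rule homogeneous_polynomial_sum, rule homogeneous_polynomial_monomial)
    fix i assume "i \<in> multi_indices B r \<times> multi_indices B s"
    then show "(\<lambda>b. fst i b + snd i b) \<in> multi_indices B (r + s)"
      by (auto simp: multi_indices_def sum.distrib)
  qed
  moreover have "f x * g x =
      (\<Sum>(\<alpha>, \<beta>)\<in>multi_indices B r \<times> multi_indices B s. c \<alpha> * d \<beta> * ?m x (\<lambda>b. \<alpha> b + \<beta> b))" for x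
    unfolding c d sum_product sum.cartesian_product
    by (intro sum.cong refl) (simp add: split_def power_add prod.distrib mult_ac)
  ultimately show ?thesis by simp
qed

lemma homogeneous_polynomial_1: "homogeneous_polynomial smul B 0 (\<lambda>x. 1)"
  using homogeneous_polynomial_monomial[of "\<lambda>_. 0" 0] by (simp add: multi_indices_def)

lemma homogeneous_polynomial_coordinate:
  assumes "b \<in> B"
  shows "homogeneous_polynomial smul B 1 (\<lambda>x. module.representation smul B x b)"
proof -
  let ?\<alpha> = "\<lambda>b'. if b' = b then 1 else 0 :: nat"
  have "(\<Prod>b'\<in>B. module.representation smul B x b' ^ ?\<alpha> b') = module.representation smul B x b" for x
    using assms finite_B by (simp add: if_distrib prod.delta cong: if_cong)
  moreover have "?\<alpha> \<in> multi_indices B 1"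
    using assms finite_B by (auto simp: multi_indices_def)
  ultimately show ?thesis
    using homogeneous_polynomial_monomial[of ?\<alpha> 1] by simp
qed

lemma homogeneous_polynomial_power:
  "homogeneous_polynomial smul B r f \<Longrightarrow> homogeneous_polynomial smul B (n * r) (\<lambda>x. f x ^ n)"
  using homogeneous_polynomial_mult[of r f]
  by (induction n) (simp_all add: homogeneous_polynomial_1)

lemma homogeneous_polynomial_prod:
  assumes "finite J" "\<And>j. j \<in> J \<Longrightarrow> homogeneous_polynomial smul B (d j) (f j)"
  shows "homogeneous_polynomial smul B (\<Sum>j\<in>J. d j) (\<lambda>x. \<Prod>j\<in>J. f j x)"
  using assms
  by (induction J rule: finite_induct)
     (simp_all add: homogeneous_polynomial_1 homogeneous_polynomial_mult)

end

section \<open>The real case\<close>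

text \<open>The form \<open>\<beta>\<close> is the polar form; the Cauchy--Schwarz inequality for it is
  the nonnegativity of \<open>\<nu>\<close> at \<open>x - (\<beta> x y / 2 \<nu> y) y\<close>.\<close>
lemma positive_definite_quadratic_form_norm:
  fixes smul :: "real \<Rightarrow> 'v::ab_group_add \<Rightarrow> 'v"
  assumes fd: "finite_dimensional_vector_space smul B"
    and q: "quadratic_form smul B \<nu>" and pos: "positive_definite \<nu>"
  shows "vector_norm abs smul (\<lambda>x. sqrt \<bar>\<nu> x\<bar>)"
proof -
  interpret finite_dimensional_vector_space smul B by (rule fd)
  have rep: "representation B (x + y) b = representation B x b + representation B y b"
    "representation B (smul t x) b = t * representation B x b" for x y t b
    using independent_Basis span_Basis by (simp_all add: representation_add representation_scale)
  obtain c where c: "\<And>x. \<nu> x = (\<Sum>\<alpha>\<in>multi_indices B 2. c \<alpha> * (\<Prod>b\<in>B. representation B x b ^ \<alpha> b))"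
    using q unfolding quadratic_form_def homogeneous_polynomial_altdef[OF finite_Basis] by blast
  obtain p q where pq: "\<And>\<alpha> z. \<alpha> \<in> multi_indices B 2 \<Longrightarrow>
      (\<Prod>b\<in>B. (z b :: real) ^ \<alpha> b) = z (p \<alpha>) * z (q \<alpha>)"
    using quadratic_monomial[OF finite_Basis] by metis
  have \<nu>: "\<nu> x = (\<Sum>\<alpha>\<in>multi_indices B 2. c \<alpha> * (representation B x (p \<alpha>) * representation B x (q \<alpha>)))" for x
    unfolding c by (intro sum.cong refl) (simp only: pq)
  define \<beta> where "\<beta> x y = (\<Sum>\<alpha>\<in>multi_indices B 2. c \<alpha> *
      (representation B x (p \<alpha>) * representation B y (q \<alpha>) +
       representation B y (p \<alpha>) * representation B x (q \<alpha>)))" for x y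
  have expand: "\<nu> (x + smul t y) = \<nu> x + t * \<beta> x y + t\<^sup>2 * \<nu> y" for x y t
    unfolding \<nu> \<beta>_def rep sum_distrib_left sum.distrib[symmetric]
    by (intro sum.cong refl) (simp add: algebra_simps power2_eq_square)
  have scale: "\<nu> (smul t x) = t\<^sup>2 * \<nu> x" for t x
    unfolding \<nu> rep sum_distrib_left by (intro sum.cong refl) (simp add: algebra_simps power2_eq_square)
  have \<nu>0: "\<nu> 0 = 0" using scale[of 0 0] by simp
  have nonneg: "0 \<le> \<nu> x" for x
    using pos \<nu>0 unfolding positive_definite_def by (cases "x = 0") (auto intro: less_imp_le)
  have cs: "\<beta> x y \<le> 2 * (sqrt (\<nu> x) * sqrt (\<nu> y))" for x y
  proof (cases "y = 0")
    case True
    have "\<beta> x 0 = 0" using expand[of x 1 0] \<nu>0 by simp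
    then show ?thesis using True \<nu>0 by simp
  next
    case False
    then have y: "0 < \<nu> y" using pos by (simp add: positive_definite_def)
    have "0 \<le> \<nu> x + (- \<beta> x y / (2 * \<nu> y)) * \<beta> x y + (- \<beta> x y / (2 * \<nu> y))\<^sup>2 * \<nu> y"
      using nonneg[of "x + smul (- \<beta> x y / (2 * \<nu> y)) y"] unfolding expand .
    also have "\<dots> = \<nu> x - (\<beta> x y)\<^sup>2 / (4 * \<nu> y)"
      using y by (simp add: field_simps power2_eq_square)
    finally have "(\<beta> x y)\<^sup>2 \<le> 4 * (\<nu> x * \<nu> y)"
      using y by (simp add: field_simps)
    then have "\<beta> x y \<le> sqrt (4 * (\<nu> x * \<nu> y))"
      by (rule real_le_rsqrt)
    then show ?thesis by (simp add: real_sqrt_mult)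
  qed
  show ?thesis
  proof unfold_locales
    fix x y and t :: real
    show "0 \<le> sqrt \<bar>\<nu> x\<bar>" by simp
    show "sqrt \<bar>\<nu> x\<bar> = 0 \<longleftrightarrow> x = 0"
      using pos \<nu>0 by (cases "x = 0") (auto simp: positive_definite_def dest: less_imp_neq)
    have "\<nu> (x + y) = \<nu> x + \<beta> x y + \<nu> y"
      using expand[of x 1 y] by simp
    also have "\<dots> \<le> (sqrt (\<nu> x) + sqrt (\<nu> y))\<^sup>2"
      using cs[of x y] nonneg by (simp add: power2_sum)
    finally have "sqrt (\<nu> (x + y)) \<le> sqrt (\<nu> x) + sqrt (\<nu> y)"
      using nonneg by (intro real_le_lsqrt) auto
    then show "sqrt \<bar>\<nu> (x + y)\<bar> \<le> sqrt \<bar>\<nu> x\<bar> + sqrt \<bar>\<nu> y\<bar>"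
      using nonneg by simp
    show "sqrt \<bar>\<nu> (smul t x)\<bar> = \<bar>t\<bar> * sqrt \<bar>\<nu> x\<bar>"
      by (simp add: scale abs_mult real_sqrt_mult)
  qed
qed

subsection \<open>Non-archimedean local fields\<close>

lemma open_plus_image:
  fixes U :: "'a::topological_field set"
  assumes "open U"
  shows "open ((+) a ` U)"
proof -
  have "(+) a ` U = (\<lambda>x. x - a) -` U"
    by (force simp: image_iff)
  then show ?thesis
    using assms by (auto intro!: open_vimage continuous_intros)
qed

lemma open_mult_image:
  fixes U :: "'a::topological_field set"
  assumes "open U" "a \<noteq> 0"
  shows "open ((*) a ` U)"
proof -
  have "(*) a ` U = (\<lambda>x. inverse a * x) -` U"
  proof (intro Set.set_eqI iffI)
    fix x assume "x \<in> (\<lambda>x. inverse a * x) -` U"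
    then have "inverse a * x \<in> U" "x = a * (inverse a * x)"
      using assms(2) by (simp_all add: field_simps)
    then show "x \<in> (*) a ` U" by blast
  qed (use assms(2) in \<open>auto simp flip: mult.assoc\<close>)
  then show ?thesis
    using assms by (auto intro!: open_vimage continuous_intros)
qed

text \<open>The tube lemma for multiplication along {0} times K: all sufficiently small scalars
  carry a compact set into a given neighbourhood of 0.\<close>

lemma times_tube:
  fixes K :: "'a::topological_field set"
  assumes "compact K" "open G" "0 \<in> G"
  obtains W where "open W" "0 \<in> W" "\<And>a. a \<in> W \<Longrightarrow> (*) a ` K \<subseteq> G"
proof -
  have G: "open ((\<lambda>p. fst p * snd p :: 'a) -` G)"
    by (rule open_vimage[OF assms(2)]) (intro continuous_intros)
  have "{0} \<times> K \<subseteq> (\<lambda>p. fst p * snd p) -` G"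
    using assms(3) by auto
  from Elementary_Topology.tube_lemma[OF assms(1) G this]
  obtain W where "0 \<in> W" "open W" "W \<times> K \<subseteq> (\<lambda>p. fst p * snd p) -` G"
    by blast
  then show ?thesis by (intro that[of W]) auto
qed

text \<open>The Haar measure is fixed along with \<open>v\<close>, so that properties of
  \<open>v\<close> can be read off from the measures of dilated sets.\<close>

locale nonarchimedean_local_field =
  fixes v :: "'k::topological_field \<Rightarrow> real" and M :: "'k measure"
  assumes locally_compact: "locally compact (UNIV :: 'k set)"
    and nondiscrete: "\<not> (\<forall>S :: 'k set. open S)"
    and haar: "haar_measure M"
    and v_nonneg: "0 \<le> v a"
    and emeasure_times: "Y \<in> sets borel \<Longrightarrow> emeasure M ((*) a ` Y) = ennreal (v a) * emeasure M Y"
    and ultrametric: "v (a + b) \<le> max (v a) (v b)"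
begin

section \<open>The scaling factor of Haar measure is an absolute value\<close>

lemmas haar_unfolded = haar[unfolded haar_measure_def]

lemmas sets_M = haar_unfolded[THEN conjunct1]
  and emeasure_UNIV_neq_0 = haar_unfolded[THEN conjunct2, THEN conjunct1]
  and emeasure_compact = haar_unfolded[THEN conjunct2, THEN conjunct2, THEN conjunct1, rule_format]
  and emeasure_borel =
    haar_unfolded[THEN conjunct2, THEN conjunct2, THEN conjunct2, THEN conjunct1, rule_format]
  and emeasure_open = haar_unfolded[THEN conjunct2, THEN conjunct2, THEN conjunct2, THEN conjunct2,
    THEN conjunct1, rule_format]
  and emeasure_plus = haar_unfolded[THEN conjunct2, THEN conjunct2, THEN conjunct2, THEN conjunct2,
    THEN conjunct2, rule_format]

text \<open>If {0} were open, so would be all its translates, and the field would be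
  discrete.\<close>

lemma ex_nonzero_in_open:
  assumes "open U" "0 \<in> U"
  shows "\<exists>a\<in>U. a \<noteq> (0 :: 'k)"
proof (rule ccontr)
  assume "\<not> (\<exists>a\<in>U. a \<noteq> 0)"
  then have "U = {0}" using assms(2) by blast
  then have "open {x}" for x :: 'k
    using open_plus_image[OF assms(1), of x] by simp
  then have "open (\<Union>x\<in>S. {x})" for S :: "'k set"
    by (intro open_UN) simp
  then have "open S" for S :: "'k set" by (metis UN_singleton)
  then show False using nondiscrete by blast
qed

lemma ex_compact_nhd:
  assumes "open W" "(0 :: 'k) \<in> W"
  obtains U K where "open U" "0 \<in> U" "U \<subseteq> K" "K \<subseteq> W" "compact K"
proof -
  have "\<exists>U K. open U \<and> compact K \<and> 0 \<in> U \<and> U \<subseteq> K \<and> K \<subseteq> W"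
    using locally_compact[unfolded locally_def, rule_format, of W 0] assms by simp
  then show ?thesis using that by blast
qed

text \<open>Finitely many translates of a nonempty open set cover any compact set. If that open set
  were null, all compact sets would be, and by inner regularity the whole space.\<close>

lemma emeasure_open_pos:
  assumes "open U" "U \<noteq> {}"
  shows "0 < emeasure M U"
proof (rule ccontr)
  assume "\<not> 0 < emeasure M U"
  then have "emeasure M U = 0" by simp
  then have null: "(+) c ` U \<in> null_sets M" for c
    using emeasure_plus[of U c] open_plus_image[OF assms(1), of c] assms(1)
    by (intro null_setsI) (simp_all add: sets_M)
  obtain u where u: "u \<in> U" using assms by blast
  have "emeasure M K = 0" if K: "compact K" for K
  proof -
    have "K \<subseteq> (\<Union>c\<in>UNIV. (+) c ` U)"
    proof
      fix x assume "x \<in> K"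
      have "(x - u) + u \<in> (+) (x - u) ` U" using u by (rule imageI)
      then show "x \<in> (\<Union>c\<in>UNIV. (+) c ` U)" by (intro UN_I[of "x - u"]) simp_all
    qed
    then obtain F where F: "finite F" "K \<subseteq> (\<Union>c\<in>F. (+) c ` U)"
      by (rule compactE_image[OF K open_plus_image[OF assms(1)]])
    have "(\<Union>c\<in>F. (+) c ` U) \<in> null_sets M"
      using null F(1) by (intro null_sets.finite_UN) auto
    then have "K \<in> null_sets M"
      by (rule null_sets_subset) (use K F(2) in \<open>simp_all add: sets_M compact_imp_closed\<close>)
    then show ?thesis by (rule null_setsD1)
  qed
  then have "emeasure M UNIV \<le> 0"
    unfolding emeasure_open[OF open_UNIV] by (intro SUP_least) simp
  then show False using emeasure_UNIV_neq_0 by simp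
qed

text \<open>A test set: its finite positive measure can be cancelled to recover the scaling factor
  from measures.\<close>

lemma ex_finite_positive_open:
  obtains U m where "open U" "0 \<in> U" "0 < m" "emeasure M U = ennreal m"
proof -
  obtain U K :: "'k set" where U: "open U" "0 \<in> U" "U \<subseteq> K" "compact K"
    using ex_compact_nhd[of UNIV] by auto
  have "emeasure M U \<le> emeasure M K"
    using U by (intro emeasure_mono) (auto simp: sets_M compact_imp_closed)
  then have "emeasure M U < top_class.top"
    using emeasure_compact[OF U(4)] by (simp add: order.strict_trans1)
  then have "emeasure M U = ennreal (measure M U)"
    by (simp add: emeasure_eq_ennreal_measure less_top)
  moreover have "0 < measure M U"
    using emeasure_open_pos[OF U(1)] U(2) calculation by (metis empty_iff ennreal_less_zero_iff)
  ultimately show ?thesis using that U by blast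
qed

lemma v_mult: "v (a * b) = v a * v b"
proof -
  obtain U :: "'k set" and m where U: "open U" "0 \<in> U" "0 < m" "emeasure M U = ennreal m"
    by (rule ex_finite_positive_open)
  have "(*) b ` U \<in> sets borel"
  proof (cases "b = 0")
    case True
    then have "(*) b ` U = {0}" using U(2) by auto
    then show ?thesis by simp
  next
    case False
    then show ?thesis using open_mult_image[OF U(1)] by simp
  qed
  then have "emeasure M ((*) a ` (*) b ` U) = ennreal (v a) * (ennreal (v b) * ennreal m)"
    using U by (simp add: emeasure_times)
  moreover have "(*) a ` (*) b ` U = (*) (a * b) ` U"
    by (simp add: image_image mult.assoc)
  moreover have "emeasure M ((*) (a * b) ` U) = ennreal (v (a * b)) * ennreal m"
    using U by (simp add: emeasure_times)
  ultimately have "ennreal (v (a * b) * m) = ennreal (v a * v b * m)"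
    using U(3) by (simp add: ennreal_mult v_nonneg mult.assoc)
  then show ?thesis
    using U(3) by (simp add: ennreal_inj v_nonneg)
qed

lemma v_1: "v 1 = 1"
proof -
  obtain U :: "'k set" and m where U: "open U" "0 \<in> U" "0 < m" "emeasure M U = ennreal m"
    by (rule ex_finite_positive_open)
  have "(*) 1 ` U = U" by (simp add: image_def)
  then have "ennreal m = ennreal (v 1 * m)"
    using emeasure_times[of U 1] U by (simp add: ennreal_mult v_nonneg)
  then show ?thesis
    using U(3) by (simp add: ennreal_inj v_nonneg)
qed

text \<open>Multiplicativity leaves only 0 or 1. If the value were 1, the point 0, and by
  translation any other point, would have the full measure of U, although U contains two
  points.\<close>

lemma v_0: "v 0 = 0"
proof (rule ccontr)
  assume "v 0 \<noteq> 0"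
  then have v: "v 0 = 1" using v_mult[of 0 0] by simp
  obtain U :: "'k set" and m where U: "open U" "0 \<in> U" "0 < m" "emeasure M U = ennreal m"
    by (rule ex_finite_positive_open)
  obtain a where a: "a \<in> U" "a \<noteq> 0"
    using ex_nonzero_in_open U by blast
  have "(*) 0 ` U = {0}" using U(2) by auto
  then have 0: "emeasure M {0} = ennreal m"
    using emeasure_times[of U 0] U v by simp
  moreover have "emeasure M {a} = ennreal m"
    using emeasure_plus[of "{0}" a] 0 by simp
  moreover have "emeasure M {0, a} = emeasure M {0} + emeasure M {a}"
    using a plus_emeasure[of "{a}" M "{0}"] by (simp add: sets_M add.commute)
  moreover have "emeasure M {0, a} \<le> emeasure M U"
    using U a by (intro emeasure_mono) (auto simp: sets_M)
  ultimately have "ennreal (m + m) \<le> ennreal m"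
    using U by simp
  then show False using U(3) by (simp add: ennreal_le_iff)
qed

lemma v_eq_0_iff: "v a = 0 \<longleftrightarrow> a = 0"
  using v_mult[of a "inverse a"] by (cases "a = 0") (auto simp: v_0 v_1)

lemma v_pos: "a \<noteq> 0 \<Longrightarrow> 0 < v a"
  using v_nonneg[of a] by (simp add: v_eq_0_iff less_le)

lemma v_inverse: "v (inverse a) = inverse (v a)"
  using v_mult[of a "inverse a"] by (cases "a = 0") (auto simp: v_0 v_1 field_simps v_eq_0_iff)

lemma v_power: "v (a ^ n) = v a ^ n"
  by (induction n) (simp_all add: v_1 v_mult)

lemma v_minus: "v (- a) = v a"
proof -
  have "v (- 1) ^ 2 = 1"
    by (simp add: v_1 flip: v_power)
  then have "v (- 1) = 1"
    using v_nonneg[of "- 1"] by (simp add: power2_eq_1_iff)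
  then show ?thesis using v_mult[of "- 1" a] by simp
qed

lemma ultrametric_diff: "v (a - b) \<le> max (v a) (v b)"
  using ultrametric[of a "- b"] by (simp add: v_minus)

text \<open>If a + b had smaller value than a, then a = (a + b) - b would be a difference of two
  elements of smaller value.\<close>

lemma v_add_eq:
  assumes "v b < v a"
  shows "v (a + b) = v a"
  using ultrametric[of a b] ultrametric_diff[of "a + b" b] assms by auto

section \<open>The absolute value defines the topology\<close>

lemma v_small:
  assumes "0 < \<epsilon>"
  obtains W where "open W" "0 \<in> W" "\<And>a. a \<in> W \<Longrightarrow> v a < \<epsilon>"
proof -
  obtain U K :: "'k set" where U: "open U" "0 \<in> U" "U \<subseteq> K" "compact K"
    using ex_compact_nhd[of UNIV] by auto
  have K: "K \<in> sets borel" "K \<in> sets M"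
    using U by (auto simp: sets_M compact_imp_closed)
  have "emeasure M K = ennreal (measure M K)"
    using emeasure_compact[OF U(4)] by (simp add: emeasure_eq_ennreal_measure less_top)
  moreover have "0 < emeasure M K"
    using emeasure_open_pos[OF U(1)] U emeasure_mono[OF U(3) K(2)] by (auto intro: order.strict_trans2)
  ultimately obtain m where m: "0 < m" "emeasure M K = ennreal m"
    by (metis ennreal_less_zero_iff)
  have "(*) 0 ` K = {0}" using U by auto
  then have "emeasure M {0} = 0"
    using emeasure_times[OF K(1), of 0] by (simp add: v_0)
  \<comment> \<open>Outer regularity of the null set {0} supplies an open G of measure below
    \<epsilon> m. Any a with a K inside G then satisfies v a * m < \<epsilon> m.\<close>
  then have "(INF G \<in> {G. open G \<and> {0} \<subseteq> G}. emeasure M G) = 0"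
    using emeasure_borel[of "{0}"] by simp
  then have "(INF G \<in> {G. open G \<and> {0} \<subseteq> G}. emeasure M G) < ennreal (\<epsilon> * m)"
    using assms m by simp
  then obtain G where G: "open G" "0 \<in> G" "emeasure M G < ennreal (\<epsilon> * m)"
    by (auto simp: INF_less_iff)
  obtain W where W: "open W" "0 \<in> W" "\<And>a. a \<in> W \<Longrightarrow> (*) a ` K \<subseteq> G"
    using times_tube[OF U(4) G(1,2)] by blast
  have "v a < \<epsilon>" if "a \<in> W" for a
  proof -
    have "ennreal (v a * m) = emeasure M ((*) a ` K)"
      using emeasure_times[OF K(1)] m by (simp add: ennreal_mult v_nonneg)
    also have "\<dots> \<le> emeasure M G"
      using W(3)[OF that] G(1) by (intro emeasure_mono) (auto simp: sets_M)
    also have "\<dots> < ennreal (\<epsilon> * m)" by (rule G(3))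
    finally show ?thesis
      using m(1) by (simp add: ennreal_less_iff v_nonneg)
  qed
  with W that show ?thesis by blast
qed

lemma continuous_on_v: "continuous_on S v"
proof -
  have "(v \<longlongrightarrow> v x) (nhds x)" for x
  proof (rule tendstoI)
    fix e :: real assume "0 < e"
    then obtain W where W: "open W" "0 \<in> W" "\<And>a. a \<in> W \<Longrightarrow> v a < e"
      by (rule v_small) blast
    have "dist (v y) (v x) < e" if y: "y \<in> (+) x ` W" for y
    proof -
      obtain w where w: "w \<in> W" "y = x + w" using y by blast
      have "v y \<le> v x + v w" "v x \<le> v y + v w"
        using ultrametric[of x w] ultrametric_diff[of y w] v_nonneg[of x] v_nonneg[of y] v_nonneg[of w] w
        by auto
      then show ?thesis using W(3)[OF w(1)] by (auto simp: dist_real_def)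
    qed
    moreover have "open ((+) x ` W)" "x \<in> (+) x ` W"
      using W open_plus_image by force+
    ultimately show "\<forall>\<^sub>F y in nhds x. dist (v y) (v x) < e"
      unfolding eventually_nhds by blast
  qed
  then show ?thesis
    unfolding continuous_on_def by (meson at_within_le_nhds tendsto_mono)
qed

lemma open_value_less: "open {x. v x < \<rho>}"
  by (intro open_Collect_less continuous_on_v continuous_on_const)

lemma closed_value_le: "closed {x. v x \<le> \<rho>}"
  by (intro closed_Collect_le continuous_on_v continuous_on_const)

text \<open>Stands in for the convergence of a^n to 0, of which only the convergence of values is
  available here. An orbit \<open>a ^ n * x\<close> inside K accumulates somewhere by compactness.
  The limit point is 0, because \<open>v\<close> is constant near a nonzero point but injective on
  the orbit.\<close>

lemma powers_absorbed:
  assumes "compact K" "open V" "0 \<in> V" "V \<subseteq> K" "a \<noteq> 0" "v a < 1" "(*) a ` K \<subseteq> V"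
  shows "\<exists>n. a ^ n * y \<in> K"
proof -
  obtain x where x: "x \<in> V" "x \<noteq> 0" using ex_nonzero_in_open[OF assms(2,3)] by blast
  have K: "a ^ n * x \<in> K" for n
  proof (induction n)
    case 0
    then show ?case using x assms(4) by auto
  next
    case (Suc n)
    then have "a * (a ^ n * x) \<in> K" using subset_trans[OF assms(7,4)] by (auto simp: image_subset_iff)
    then show ?case by (simp only: power_Suc mult.assoc)
  qed
  have inj: "i = j" if "v (a ^ i * x) = v (a ^ j * x)" for i j
  proof -
    have "v a ^ i = v a ^ j" using that v_pos[OF x(2)] by (simp add: v_mult v_power)
    then show ?thesis
      using v_pos[OF assms(5)] assms(6) power_strict_decreasing[of i j "v a"]
        power_strict_decreasing[of j i "v a"] by (cases i j rule: linorder_cases) auto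
  qed
  have "inj (\<lambda>n. a ^ n * x)"
    by (rule injI, rule inj) (rule arg_cong)
  then have "infinite (range (\<lambda>n. a ^ n * x))"
    by (rule range_inj_infinite)
  then obtain b where b: "b \<in> K" "b islimpt range (\<lambda>n. a ^ n * x)"
    using Heine_Borel_imp_Bolzano_Weierstrass[OF assms(1)] K by blast
  have "b = 0"
  proof (rule ccontr)
    assume "b \<noteq> 0"
    define N where "N = (+) b ` {x. v x < v b}"
    have "open N" "b \<in> N"
      using open_plus_image[OF open_value_less, of b] v_pos[OF \<open>b \<noteq> 0\<close>]
      by (simp_all add: N_def image_iff v_0)
    have N: "v y = v b" if "y \<in> N" for y
      using that v_add_eq[of _ b] by (auto simp: N_def)
    obtain i where i: "a ^ i * x \<in> N" "a ^ i * x \<noteq> b"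
      using islimptE[OF b(2) \<open>b \<in> N\<close> \<open>open N\<close>] by blast
    \<comment> \<open>Removing the first orbit point from N yields a second, different one with the
      same value.\<close>
    have "b \<in> N - {a ^ i * x}" "open (N - {a ^ i * x})"
      using \<open>open N\<close> \<open>b \<in> N\<close> i(2) by (simp_all add: open_delete)
    then obtain t where "t \<in> range (\<lambda>n. a ^ n * x)" "t \<in> N - {a ^ i * x}"
      by (rule islimptE[OF b(2)])
    then obtain j where j: "a ^ j * x \<in> N - {a ^ i * x}"
      by (elim rangeE) (simp only:)
    then have "v (a ^ i * x) = v (a ^ j * x)" using N[OF i(1)] N[of "a ^ j * x"] by simp
    then show False using inj j by blast
  qed
  \<comment> \<open>As a^n y is a^n x times the constant y/x, an orbit point close enough to 0
    brings a^n y into V.\<close>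
  have open_V: "open ((\<lambda>t. t * (inverse x * y)) -` V)"
    by (rule open_vimage[OF assms(2)]) (intro continuous_intros)
  have "0 \<in> (\<lambda>t. t * (inverse x * y)) -` V" using assms(3) by simp
  then obtain t where "t \<in> range (\<lambda>n. a ^ n * x)" "t \<in> (\<lambda>t. t * (inverse x * y)) -` V"
    by (rule islimptE[OF b(2)[unfolded \<open>b = 0\<close>] _ open_V])
  then obtain n where "a ^ n * x * (inverse x * y) \<in> V"
    by (elim rangeE) simp
  moreover have "a ^ n * x * (inverse x * y) = a ^ n * y" using x(2) by (simp add: field_simps)
  ultimately have "a ^ n * y \<in> K" using assms(4) by auto
  then show ?thesis ..
qed

text \<open>Converse to \<open>v_small\<close>: a point outside the compact neighbourhood K enters K
  under powers of a through the shell \<open>L\<close>, on which \<open>v\<close> is bounded below.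
  Since v a < 1, the point itself has at least that value.\<close>

lemma small_ball_subset:
  assumes "open U" "0 \<in> U"
  obtains \<delta> where "0 < \<delta>" "{x. v x < \<delta>} \<subseteq> U"
proof -
  obtain V K where V: "open V" "0 \<in> V" "V \<subseteq> K" "K \<subseteq> U" "compact K"
    using ex_compact_nhd[OF assms] by blast
  obtain W where W: "open W" "0 \<in> W" "\<And>a. a \<in> W \<Longrightarrow> (*) a ` K \<subseteq> V"
    using times_tube[OF V(5) V(1,2)] by blast
  have "open (W \<inter> {x. v x < 1})" "0 \<in> W \<inter> {x. v x < 1}"
    using W open_value_less by (auto simp: v_0)
  then obtain a where a: "a \<in> W" "v a < 1" "a \<noteq> 0"
    using ex_nonzero_in_open by blast
  define L where "L = K - (*) a ` V"
  have "compact L"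
    unfolding L_def using V open_mult_image a by (intro compact_diff) auto
  moreover have "0 \<notin> L" using V(2) by (auto simp: L_def)
  ultimately obtain \<delta> where \<delta>: "0 < \<delta>" "\<And>x. x \<in> L \<Longrightarrow> \<delta> \<le> v x"
  proof (cases "L = {}")
    case False
    then obtain x where "x \<in> L" "\<forall>y\<in>L. v x \<le> v y"
      using continuous_attains_inf[OF \<open>compact L\<close> False continuous_on_v] by blast
    moreover from this have "x \<noteq> 0" using \<open>0 \<notin> L\<close> by metis
    ultimately show ?thesis using that[of "v x"] v_pos by blast
  qed (auto intro: that[of 1])
  have "y \<in> K" if y: "v y < \<delta>" for y
  proof -
    have ex: "\<exists>n. a ^ n * y \<in> K"
      by (rule powers_absorbed[OF V(5) V(1-3) a(3,2) W(3)[OF a(1)]])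
    \<comment> \<open>At the first entry into K with n > 0, the previous iterate lies outside K and
      hence outside V, so the entry point avoids a V and lies in \<open>L\<close>.\<close>
    define n where "n = (LEAST n. a ^ n * y \<in> K)"
    have n: "a ^ n * y \<in> K" unfolding n_def using ex by (rule LeastI_ex)
    show ?thesis
    proof (cases n)
      case 0
      then show ?thesis using n by simp
    next
      case (Suc k)
      then have "a ^ k * y \<notin> K"
        using not_less_Least[of k "\<lambda>n. a ^ n * y \<in> K"] by (simp add: n_def)
      then have "a ^ n * y \<notin> (*) a ` V"
        using V(3) a(3) by (auto simp: Suc mult.assoc)
      then have "\<delta> \<le> v (a ^ n * y)" using n \<delta>(2) by (simp add: L_def)
      also have "\<dots> \<le> 1 * v y"
        unfolding v_mult v_power using a(2) v_nonneg by (intro mult_right_mono power_le_one) auto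
      finally show ?thesis using y by simp
    qed
  qed
  with V(4) \<delta>(1) that show ?thesis by blast
qed

section \<open>Finiteness of the unit ball's measure and its consequences\<close>

lemma emeasure_unit_ball_finite: "emeasure M {x. v x \<le> 1} < \<infinity>"
proof -
  obtain U K :: "'k set" where U: "open U" "0 \<in> U" "U \<subseteq> K" "compact K"
    using ex_compact_nhd[of UNIV] by auto
  obtain \<delta> where \<delta>: "0 < \<delta>" "{x. v x < \<delta>} \<subseteq> U"
    using small_ball_subset[OF U(1,2)] by blast
  have "0 \<in> {x. v x < \<delta>}" using \<delta>(1) by (simp add: v_0)
  then obtain c where c: "v c < \<delta>" "c \<noteq> 0"
    using ex_nonzero_in_open[OF open_value_less[of \<delta>]] by blast
  \<comment> \<open>Scaling by a small nonzero c puts the unit ball inside K and multiplies its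
    measure by the positive number v c.\<close>
  have "v (c * x) < \<delta>" if "v x \<le> 1" for x
    using mult_left_mono[OF that v_nonneg[of c]] c by (simp add: v_mult)
  then have "(*) c ` {x. v x \<le> 1} \<subseteq> K"
    using \<delta>(2) U(3) by blast
  then have "emeasure M ((*) c ` {x. v x \<le> 1}) \<le> emeasure M K"
    using U by (intro emeasure_mono) (auto simp: sets_M compact_imp_closed)
  also have "\<dots> < \<infinity>" by (rule emeasure_compact[OF U(4)])
  finally have "ennreal (v c) * emeasure M {x. v x \<le> 1} < \<infinity>"
    using closed_value_le by (simp add: emeasure_times)
  then show ?thesis
    using v_pos[OF c(2)] by (auto simp: ennreal_mult_less_top)
qed

text \<open>The balls of radius \<open>\<rho>\<close> around the points of \<open>S\<close> are disjoint, have the same positive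
  measure and lie in the unit ball.\<close>
lemma finite_separated:
  assumes "0 < \<rho>" "\<rho> \<le> 1" "\<And>x. x \<in> S \<Longrightarrow> v x \<le> 1"
    and sep: "\<And>x y. \<lbrakk>x \<in> S; y \<in> S; x \<noteq> y\<rbrakk> \<Longrightarrow> \<rho> \<le> v (x - y)"
  shows "finite S"
proof -
  define D where "D = {x. v x < \<rho>}"
  have D: "open D" "0 \<in> D" using assms(1) open_value_less by (auto simp: D_def v_0)
  have "emeasure M D \<le> emeasure M {x. v x \<le> 1}"
    using assms(2) closed_value_le by (intro emeasure_mono) (auto simp: D_def sets_M)
  then have "emeasure M D < top_class.top"
    using emeasure_unit_ball_finite by (simp add: order.strict_trans1)
  then obtain d where d: "0 < d" "emeasure M D = ennreal d"
    using emeasure_open_pos[of D] D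
    by (metis emeasure_eq_ennreal_measure empty_iff ennreal_less_zero_iff less_top)
  obtain C where C: "0 \<le> C" "emeasure M {x. v x \<le> 1} = ennreal C"
    using emeasure_unit_ball_finite by (metis enn2real_nonneg ennreal_enn2real infinity_ennreal_def)
  have "card G \<le> nat \<lfloor>C / d\<rfloor>" if G: "G \<subseteq> S" "finite G" for G
  proof -
    have "disjoint_family_on (\<lambda>x. (+) x ` D) G"
      unfolding disjoint_family_on_def
    proof (intro ballI impI)
      fix x y assume xy: "x \<in> G" "y \<in> G" "x \<noteq> y"
      show "(+) x ` D \<inter> (+) y ` D = {}"
      proof (rule ccontr)
        assume "(+) x ` D \<inter> (+) y ` D \<noteq> {}"
        then obtain s t where "s \<in> D" "t \<in> D" "x + s = y + t" by blast
        then have "x - y = t - s" "v (t - s) < \<rho>"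
          using ultrametric_diff[of t s] by (auto simp: D_def algebra_simps)
        then show False using sep[of x y] xy G(1) by auto
      qed
    qed
    then have "(\<Sum>x\<in>G. emeasure M ((+) x ` D)) = emeasure M (\<Union>x\<in>G. (+) x ` D)"
      using open_plus_image[OF D(1)] G by (intro sum_emeasure) (auto simp: sets_M)
    also have "\<dots> \<le> emeasure M {x. v x \<le> 1}"
    proof (rule emeasure_mono)
      show "(\<Union>x\<in>G. (+) x ` D) \<subseteq> {x. v x \<le> 1}"
      proof safe
        fix x s assume "x \<in> G" "s \<in> D"
        then show "v (x + s) \<le> 1"
          using ultrametric[of x s] assms(2) assms(3)[of x] G(1) by (auto simp: D_def)
      qed
    qed (use closed_value_le in \<open>auto simp: sets_M\<close>)
    finally have "ennreal (of_nat (card G) * d) \<le> ennreal C"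
      using D d C by (simp add: emeasure_plus ennreal_mult ennreal_of_nat_eq_real_of_nat)
    then have "real (card G) \<le> C / d"
      using d C by (simp add: field_simps)
    then show ?thesis by linarith
  qed
  then show ?thesis using finite_if_finite_subsets_card_bdd by blast
qed

text \<open>Elements of distinct values at least v c differ by at least v c, so
  \<open>finite_separated\<close> leaves finitely many values between v c and 1. The largest of
  these bounds the smaller values too.\<close>

lemma uniformizer:
  obtains \<pi> where "\<pi> \<noteq> 0" "v \<pi> < 1" "\<And>x. v x < 1 \<Longrightarrow> v x \<le> v \<pi>"
proof -
  have "0 \<in> {x. v x < 1}" by (simp add: v_0)
  then obtain c where c: "v c < 1" "c \<noteq> 0"
    using ex_nonzero_in_open[OF open_value_less[of 1]] by blast
  define Y where "Y = v ` {x. v c \<le> v x \<and> v x < 1}"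
  define g where "g = inv_into {x. v c \<le> v x \<and> v x < 1} v"
  have g: "v (g t) = t" "v c \<le> t" "t < 1" if "t \<in> Y" for t
    using that by (auto simp: g_def Y_def f_inv_into_f)
  have "finite (g ` Y)"
  proof (rule finite_separated[of "v c"])
    fix x y assume "x \<in> g ` Y" "y \<in> g ` Y" "x \<noteq> y"
    then have "v x \<noteq> v y" "v c \<le> v x" "v c \<le> v y" using g by auto
    then show "v c \<le> v (x - y)"
      using v_add_eq[of "- y" x] v_add_eq[of x "- y"] by (auto simp: v_minus add.commute neq_iff)
  qed (use c g v_pos in \<open>auto intro: less_imp_le\<close>)
  then have "finite (v ` g ` Y)" by simp
  moreover have "v ` g ` Y = Y"
    using g by force
  ultimately have fin: "finite Y" by simp
  have "v c \<in> Y" using c by (auto simp: Y_def)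
  then have max: "Max Y \<in> Y" "\<And>t. t \<in> Y \<Longrightarrow> t \<le> Max Y"
    using Max_in[OF fin] Max_ge[OF fin] by blast+
  show ?thesis
  proof (rule that[of "g (Max Y)"])
    show "v (g (Max Y)) < 1" using g max by simp
    show "g (Max Y) \<noteq> 0" using g(1,2)[OF max(1)] v_pos[OF c(2)] by (auto simp: v_0)
    show "v x \<le> v (g (Max Y))" if "v x < 1" for x
    proof (cases "v c \<le> v x")
      case True
      then show ?thesis using that max g(1)[OF max(1)] by (auto simp: Y_def)
    next
      case False
      then show ?thesis using g(1,2)[OF max(1)] by simp
    qed
  qed
qed

text \<open>One inclusion uses the continuity of \<open>v\<close>, the other that small balls lie in
  every neighbourhood of 0.\<close>

lemma nilpotents_eq: "(nilpotents :: 'k set) = {x. v x < 1}"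
proof safe
  fix x :: 'k assume "x \<in> nilpotents"
  then have "(\<lambda>n. x ^ n) \<longlonglongrightarrow> 0" by (simp add: nilpotents_def)
  then have "\<forall>\<^sub>F n in sequentially. x ^ n \<in> {x. v x < 1}"
    by (rule topological_tendstoD[OF _ open_value_less]) (simp add: v_0)
  then obtain n where "v (x ^ n) < 1"
    by (auto simp: eventually_sequentially)
  then show "v x < 1"
    unfolding v_power using one_le_power[of "v x" n] by linarith
next
  fix x :: 'k assume x: "v x < 1"
  have "(\<lambda>n. x ^ n) \<longlonglongrightarrow> 0"
  proof (rule topological_tendstoI)
    fix U :: "'k set" assume "open U" "0 \<in> U"
    then obtain \<delta> where \<delta>: "0 < \<delta>" "{x. v x < \<delta>} \<subseteq> U"
      by (rule small_ball_subset)
    have "(\<lambda>n. v x ^ n) \<longlonglongrightarrow> 0"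
      using x v_nonneg by (intro LIMSEQ_power_zero) simp
    then have "\<forall>\<^sub>F n in sequentially. v x ^ n < \<delta>"
      using \<delta>(1) by (rule order_tendstoD)
    then show "\<forall>\<^sub>F n in sequentially. x ^ n \<in> U"
      by eventually_elim (use \<delta>(2) in \<open>auto simp: v_power\<close>)
  qed
  then show "x \<in> nilpotents" by (simp add: nilpotents_def)
qed

lemma integers_eq: "(integers :: 'k set) = {x. v x \<le> 1}"
proof (intro Set.set_eqI)
  fix x :: 'k
  show "x \<in> integers \<longleftrightarrow> x \<in> {x. v x \<le> 1}"
  proof (cases "x = 0")
    case False
    then have "v (inverse x) < 1 \<longleftrightarrow> 1 < v x"
      using v_pos[OF False] by (simp add: v_inverse inverse_less_1_iff)
    with False show ?thesis
      by (simp add: integers_def nilpotents_eq not_less)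
  qed (simp add: integers_def v_0)
qed

lemma valuation_pair: "valuation_pair integers (nilpotents :: 'k set)"
proof -
  have "v (x - y) \<le> 1" "v (x * y) \<le> 1" if "v x \<le> 1" "v y \<le> 1" for x y
    using that ultrametric_diff[of x y] v_nonneg by (auto simp: v_mult mult_le_one)
  moreover have "v (x - y) < 1" if "v x < 1" "v y < 1" for x y
    using that ultrametric_diff[of x y] by simp
  moreover have "v (x * y) < 1" if "v x \<le> 1" "v y < 1" for x y
    using that mult_right_mono[of "v x" 1 "v y"] v_nonneg by (simp add: v_mult)
  moreover have "v (inverse x) \<le> 1" if "v x \<le> 1" "\<not> v x < 1" for x
    using that by (simp add: v_inverse)
  ultimately show ?thesis
    unfolding valuation_pair_def integers_eq nilpotents_eq by (auto simp: v_0 v_1)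
qed

text \<open>The topological description yields a genuine valuation pair here, so the fallback pair
  is not taken.\<close>

lemma residue_ring_eq: "residue_ring = {x. v x \<le> 1}"
  and residue_ideal_eq: "residue_ideal = {x. v x < 1}"
  using valuation_pair by (simp_all add: residue_ring_def residue_ideal_def integers_eq nilpotents_eq)

text \<open>Representatives of distinct classes differ by an element outside the maximal ideal and
  are therefore separated by distance 1.\<close>

lemma finite_residue_field: "finite (UNIV :: 'k residue set)"
proof -
  obtain g :: "'k residue \<Rightarrow> 'k" where g: "\<And>y. g y \<in> residue_ring" "\<And>y. to_residue (g y) = y"
    using to_residue_surj by metis
  have "finite (range g)"
  proof (rule finite_separated[of 1])
    fix x y assume xy: "x \<in> range g" "y \<in> range g" "x \<noteq> y"
    then have "to_residue x \<noteq> to_residue y" using g(2) by auto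
    then show "1 \<le> v (x - y)"
      using xy g(1) to_residue_eq_iff[of x y] by (auto simp: residue_ideal_eq)
  qed (use g(1) in \<open>auto simp: residue_ring_eq\<close>)
  then have "finite (to_residue ` range g)" by simp
  moreover have "to_residue ` range g = UNIV" using g(2) by (auto simp: image_iff)
  ultimately show ?thesis by simp
qed

section \<open>Values of sums, and lifting the norm form\<close>

lemma ex_max_value:
  assumes "finite I" "I \<noteq> {}"
  shows "\<exists>i\<in>I. \<forall>j\<in>I. v (t j) \<le> v (t i)"
proof -
  let ?T = "(\<lambda>i. v (t i)) ` I"
  have fin: "finite ?T" using assms(1) by simp
  have "Max ?T \<in> ?T" using fin assms(2) by (intro Max_in) simp_all
  then obtain i where i: "i \<in> I" "Max ?T = v (t i)" by blast
  have "v (t j) \<le> v (t i)" if "j \<in> I" for j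
    using Max_ge[OF fin imageI[OF that]] by (simp only: i(2))
  with i(1) show ?thesis by blast
qed

lemma v_sum_less:
  assumes "0 < \<rho>" "\<And>i. i \<in> I \<Longrightarrow> v (t i) < \<rho>"
  shows "v (\<Sum>i\<in>I. t i) < \<rho>"
  using assms(2)
proof (induction I rule: infinite_finite_induct)
  case (insert i I)
  then show ?case
    using ultrametric[of "t i" "\<Sum>i\<in>I. t i"] by fastforce
qed (use assms(1) in \<open>simp_all add: v_0\<close>)

text \<open>Several summands may vanish, so distinctness is asked of nonzero ones only. A nonzero
  summand of largest value strictly dominates the sum of the others.\<close>

lemma v_sum_distinct:
  assumes "finite I" "I \<noteq> {}"
    and distinct: "\<And>i j. \<lbrakk>i \<in> I; j \<in> I; i \<noteq> j; t i \<noteq> 0\<rbrakk> \<Longrightarrow> v (t i) \<noteq> v (t j)"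
  shows "\<exists>i\<in>I. v (\<Sum>i\<in>I. t i) = v (t i) \<and> (\<forall>j\<in>I. v (t j) \<le> v (t i))"
proof -
  obtain i where i: "i \<in> I" "\<And>j. j \<in> I \<Longrightarrow> v (t j) \<le> v (t i)"
    using ex_max_value[OF assms(1,2)] by blast
  have "v (\<Sum>i\<in>I. t i) = v (t i)"
  proof (cases "t i = 0")
    case True
    have "t j = 0" if "j \<in> I" for j
      using i(2)[OF that] True v_pos[of "t j"] by (force simp: v_0)
    then show ?thesis using True by (simp add: sum.neutral)
  next
    case False
    have "v (t j) < v (t i)" if "j \<in> I - {i}" for j
      using i(2)[of j] distinct[OF i(1), of j] False that by auto
    then have "v (\<Sum>j\<in>I - {i}. t j) < v (t i)"
      by (rule v_sum_less[OF v_pos[OF False]])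
    then show ?thesis
      by (simp add: sum.remove[OF assms(1) i(1)] v_add_eq)
  qed
  with i show ?thesis by blast
qed

text \<open>A form over the residue field without nontrivial zeros is lifted coefficientwise; by
  homogeneity it suffices to evaluate the lift at vectors of norm \<open>1\<close>.\<close>
lemma ex_norm_form:
  fixes r :: nat
  assumes r: "0 < r"
  shows "\<exists>A c. (\<forall>\<alpha>\<in>A. (\<Sum>j<r. \<alpha> j) = r) \<and>
    (\<forall>y. \<exists>s<r. v (\<Sum>\<alpha>\<in>A. c \<alpha> * (\<Prod>j<r. y j ^ \<alpha> j)) = v (y s) ^ r \<and> (\<forall>j<r. v (y j) \<le> v (y s)))"
proof -
  obtain A and c\<^sub>0 :: "(nat \<Rightarrow> nat) \<Rightarrow> 'k residue"
    where A: "\<forall>\<alpha>\<in>A. (\<Sum>j<r. \<alpha> j) = r"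
      and aniso: "\<forall>y. (\<Sum>\<alpha>\<in>A. c\<^sub>0 \<alpha> * (\<Prod>j<r. y j ^ \<alpha> j)) = 0 \<longrightarrow> (\<forall>j<r. y j = 0)"
    using anisotropic_form[OF finite_residue_field r] by (elim exE conjE)
  have "\<forall>\<alpha>. \<exists>x. x \<in> residue_ring \<and> to_residue x = c\<^sub>0 \<alpha>"
    using to_residue_surj by blast
  then obtain c where "\<forall>\<alpha>. c \<alpha> \<in> residue_ring \<and> to_residue (c \<alpha>) = c\<^sub>0 \<alpha>"
    by (rule choice[THEN exE])
  then have c: "\<And>\<alpha>. c \<alpha> \<in> residue_ring" "\<And>\<alpha>. to_residue (c \<alpha>) = c\<^sub>0 \<alpha>"
    by simp_all
  define f where "f y = (\<Sum>\<alpha>\<in>A. c \<alpha> * (\<Prod>j<r. y j ^ \<alpha> j))" for y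
  have homogeneous: "f (\<lambda>j. a * y j) = a ^ r * f y" for a y
    unfolding f_def sum_distrib_left
  proof (rule sum.cong)
    fix \<alpha> assume "\<alpha> \<in> A"
    then have "(\<Prod>j<r. a ^ \<alpha> j) = a ^ r" by (simp add: A flip: power_sum)
    then show "c \<alpha> * (\<Prod>j<r. (a * y j) ^ \<alpha> j) = a ^ r * (c \<alpha> * (\<Prod>j<r. y j ^ \<alpha> j))"
      by (simp add: power_mult_distrib prod.distrib)
  qed simp
  have unit: "v (f y) = 1" if y: "\<And>j. j < r \<Longrightarrow> v (y j) \<le> 1" and s: "s < r" "v (y s) = 1" for y s
  proof -
    have ring: "y j \<in> residue_ring" if "j < r" for j
      using y[OF that] by (simp add: residue_ring_eq)
    have monomial: "(\<Prod>j<r. y j ^ \<alpha> j) \<in> residue_ring \<and>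
        to_residue (\<Prod>j<r. y j ^ \<alpha> j) = (\<Prod>j<r. to_residue (y j) ^ \<alpha> j)" for \<alpha>
      using to_residue_prod[of "{..<r}" "\<lambda>j. y j ^ \<alpha> j"] ring
      by (simp add: residue_ring_power to_residue_power)
    have f: "f y \<in> residue_ring \<and>
        to_residue (f y) = (\<Sum>\<alpha>\<in>A. c\<^sub>0 \<alpha> * (\<Prod>j<r. to_residue (y j) ^ \<alpha> j))"
      using to_residue_sum[of A "\<lambda>\<alpha>. c \<alpha> * (\<Prod>j<r. y j ^ \<alpha> j)"] monomial c
      by (simp add: f_def residue_ring_mult to_residue_mult)
    have "to_residue (f y) \<noteq> 0"
    proof
      assume "to_residue (f y) = 0"
      then have "\<forall>j<r. to_residue (y j) = 0"
        using aniso[THEN spec, of "\<lambda>j. to_residue (y j)"] f by simp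
      then have "to_residue (y s) = 0" using s(1) by simp
      then show False
        using s ring by (simp add: to_residue_eq_0_iff residue_ideal_eq)
    qed
    moreover have "f y \<in> residue_ring" using f by blast
    ultimately have "\<not> v (f y) < 1" "v (f y) \<le> 1"
      by (simp_all add: to_residue_eq_0_iff residue_ideal_eq residue_ring_eq)
    then show ?thesis by simp
  qed
  have "\<exists>s<r. v (f y) = v (y s) ^ r \<and> (\<forall>j<r. v (y j) \<le> v (y s))" for y
  proof -
    obtain s where s: "s < r" "\<And>j. j < r \<Longrightarrow> v (y j) \<le> v (y s)"
      using ex_max_value[of "{..<r}" y] r by auto
    have "v (f y) = v (y s) ^ r"
    proof (cases "y s = 0")
      case True
      \<comment> \<open>The largest coordinate is zero, hence all are, and homogeneity with factor 0
        gives f y = 0.\<close>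
      have "f y = f (\<lambda>j. 0 * y j)"
        unfolding f_def
      proof (intro sum.cong prod.cong refl arg_cong2[where f = "(*)"])
        fix \<alpha> j assume "j \<in> {..<r}"
        then have "v (y j) \<le> 0" using s(2)[of j] True by (simp add: v_0)
        then have "y j = 0" using v_pos[of "y j"] by force
        then show "y j ^ \<alpha> j = (0 * y j) ^ \<alpha> j" by simp
      qed
      also have "\<dots> = 0" using homogeneous[of 0] r by (simp add: power_0_left)
      finally show ?thesis using True r by (simp add: v_0 power_0_left)
    next
      case False
      have "v (f (\<lambda>j. y j / y s)) = 1"
      proof (rule unit)
        have v: "v (y j / y s) = v (y j) / v (y s)" for j
          by (simp add: divide_inverse v_mult v_inverse)
        show "v (y j / y s) \<le> 1" if "j < r" for j
          unfolding v using s(2)[OF that] v_pos[OF False] by simp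
        show "v (y s / y s) = 1" using False by (simp add: v_1)
      qed (rule s(1))
      moreover have "f y = y s ^ r * f (\<lambda>j. y j / y s)"
        using False by (simp flip: homogeneous)
      ultimately show ?thesis by (simp add: v_mult v_power)
    qed
    with s show ?thesis by blast
  qed
  then have "\<forall>y. \<exists>s<r. v (f y) = v (y s) ^ r \<and> (\<forall>j<r. v (y j) \<le> v (y s))" by (rule allI)
  with A show ?thesis unfolding f_def by (intro exI conjI)
qed

text \<open>The value of the \<open>i\<close>-th summand is \<open>v \<pi> ^ i\<close> times an \<open>r\<close>-th power, so the nonzero
  summands with \<open>i < r\<close> have distinct values.\<close>
lemma uniformizer_powers_distinct:
  assumes \<pi>: "\<pi> \<noteq> 0" "\<And>x. v x < 1 \<Longrightarrow> v x \<le> v \<pi>" "v \<pi> < 1"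
    and ij: "i < j" "j < r" and x: "x \<noteq> 0"
  shows "v \<pi> ^ i * v x ^ r \<noteq> v \<pi> ^ j * v y ^ r"
proof
  assume eq: "v \<pi> ^ i * v x ^ r = v \<pi> ^ j * v y ^ r"
  have p: "0 < v \<pi>" "0 < v x" using \<pi>(1) x by (simp_all add: v_pos)
  have "0 < v \<pi> ^ j * v y ^ r"
    unfolding eq[symmetric] using p by simp
  then have y: "0 < v y"
    using v_nonneg[of y] ij by (cases "v y = 0") (auto simp: power_0_left)
  have "v \<pi> ^ j = v \<pi> ^ i * v \<pi> ^ (j - i)"
    using ij by (simp flip: power_add)
  then have "v x ^ r = v \<pi> ^ (j - i) * v y ^ r"
    using eq p by (simp add: mult.assoc)
  moreover have "v (x / y) = v x / v y"
    by (simp add: divide_inverse v_mult v_inverse)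
  ultimately have u: "v (x / y) ^ r = v \<pi> ^ (j - i)"
    using y by (simp add: power_divide)
  \<comment> \<open>Since 0 < j - i < r, the value of x/y would lie strictly between v \<pi> and 1,
    against the maximality of v \<pi>.\<close>
  have "v (x / y) < 1"
  proof (rule ccontr)
    assume "\<not> v (x / y) < 1"
    then have "1 \<le> v (x / y) ^ r" by (simp add: one_le_power)
    moreover have "v \<pi> ^ (j - i) < 1"
      using p \<pi>(3) ij by (simp add: power_less_one_iff)
    ultimately show False using u by simp
  qed
  then have "v (x / y) ^ r \<le> v \<pi> ^ r"
    using \<pi>(2) v_nonneg by (intro power_mono) auto
  also have "\<dots> < v \<pi> ^ (j - i)"
    using p \<pi>(3) ij by (intro power_strict_decreasing) auto
  finally show False using u by simp
qed

section \<open>The form on a space of dimension at most r^2\<close>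

lemma ex_definite_form:
  fixes smul :: "'k \<Rightarrow> 'w::ab_group_add \<Rightarrow> 'w"
  assumes fd: "finite_dimensional_vector_space smul B"
    and r: "0 < r" and dim: "card B \<le> r\<^sup>2"
  shows "\<exists>\<nu>. homogeneous_polynomial smul B r \<nu> \<and> definite \<nu> \<and>
    nonarchimedean_vector_norm v smul (\<lambda>x. root r (v (\<nu> x)))"
proof -
  interpret finite_dimensional_vector_space smul B by (rule fd)
  have rep: "representation B (x + y) b = representation B x b + representation B y b"
    "representation B (smul t x) b = t * representation B x b" for x y t b
    using independent_Basis span_Basis by (simp_all add: representation_add representation_scale)
  have rep_0: "x = 0" if "\<And>b. b \<in> B \<Longrightarrow> representation B x b = 0" for x
    using sum_representation_eq[OF independent_Basis _ finite_Basis order.refl, of x] span_Basis that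
    by simp
  have "card B \<le> card ({..<r} \<times> {..<r})"
    using dim by (simp add: power2_eq_square)
  then obtain g where g: "inj_on g B" "g ` B \<subseteq> {..<r} \<times> {..<r}"
    using card_le_inj[OF finite_Basis, of "{..<r} \<times> {..<r}"] by auto
  define Y where "Y i j x = (if (i, j) \<in> g ` B then representation B x (inv_into B g (i, j)) else 0)" for i j x
  have Y_coordinate: "Y (fst (g b)) (snd (g b)) x = representation B x b" if "b \<in> B" for b x
    using that g(1) by (simp add: Y_def)
  have Y_cases: "Y i j x = 0 \<or> (\<exists>b\<in>B. g b = (i, j) \<and> Y i j x = representation B x b)" for i j x
    using g(1) by (auto simp: Y_def)
  have Y_hom: "homogeneous_polynomial smul B 1 (Y i j)" for i j
  proof (cases "(i, j) \<in> g ` B")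
    case True
    then have "Y i j = (\<lambda>x. representation B x (inv_into B g (i, j)))" by (simp add: Y_def fun_eq_iff)
    then show ?thesis
      using homogeneous_polynomial_coordinate[OF finite_Basis inv_into_into[OF True]] by simp
  next
    case False
    then have "Y i j = (\<lambda>x. 0)" by (simp add: Y_def fun_eq_iff)
    then show ?thesis using homogeneous_polynomial_0[OF finite_Basis] by simp
  qed
  obtain A :: "(nat \<Rightarrow> nat) set" and c
    where A: "\<forall>\<alpha>\<in>A. (\<Sum>j<r. \<alpha> j) = r"
      and f: "\<forall>y. \<exists>s<r. v (\<Sum>\<alpha>\<in>A. c \<alpha> * (\<Prod>j<r. y j ^ \<alpha> j)) = v (y s) ^ r \<and> (\<forall>j<r. v (y j) \<le> v (y s))"
    using ex_norm_form[OF r] by (elim exE conjE)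
  obtain \<pi> where \<pi>: "\<pi> \<noteq> 0" "v \<pi> < 1" "\<And>x. v x < 1 \<Longrightarrow> v x \<le> v \<pi>"
    by (rule uniformizer) blast
  define t where "t i x = \<pi> ^ i * (\<Sum>\<alpha>\<in>A. c \<alpha> * (\<Prod>j<r. Y i j x ^ \<alpha> j))" for i x
  define \<nu> where "\<nu> x = (\<Sum>i<r. t i x)" for x
  have homogeneous: "homogeneous_polynomial smul B r \<nu>"
    unfolding \<nu>_def t_def
  proof (rule homogeneous_polynomial_sum[OF finite_Basis], rule homogeneous_polynomial_sum[OF finite_Basis])
    fix i \<alpha> assume "\<alpha> \<in> A"
    have "homogeneous_polynomial smul B (\<Sum>j<r. \<alpha> j * 1) (\<lambda>x. \<Prod>j<r. Y i j x ^ \<alpha> j)"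
      by (intro homogeneous_polynomial_prod[OF finite_Basis] homogeneous_polynomial_power[OF finite_Basis] Y_hom)
         (simp)
    then show "homogeneous_polynomial smul B r (\<lambda>x. \<Prod>j<r. Y i j x ^ \<alpha> j)"
      using A \<open>\<alpha> \<in> A\<close> by simp
  qed
  have t: "\<exists>s<r. v (t i x) = v \<pi> ^ i * v (Y i s x) ^ r \<and> (\<forall>j<r. v (Y i j x) \<le> v (Y i s x))" for i x
    using f[THEN spec, of "\<lambda>j. Y i j x"] by (auto simp: t_def v_mult v_power)
  have t_distinct: "v (t i x) \<noteq> v (t j x)" if "i < r" "j < r" "i \<noteq> j" "t i x \<noteq> 0" for i j x
  proof
    assume eq: "v (t i x) = v (t j x)"
    then have j: "t j x \<noteq> 0" using that by (metis v_eq_0_iff)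
    obtain a b where ab: "v (t i x) = v \<pi> ^ i * v a ^ r" "v (t j x) = v \<pi> ^ j * v b ^ r"
      using t by metis
    have "a \<noteq> 0" "b \<noteq> 0" using that(4) j ab r by (auto simp: v_0 v_eq_0_iff power_0_left)
    then show False
      using uniformizer_powers_distinct[OF \<pi>(1,3,2), of i j r a b]
        uniformizer_powers_distinct[OF \<pi>(1,3,2), of j i r b a] that eq ab
      by (cases i j rule: linorder_cases) auto
  qed
  \<comment> \<open>The weight of the block containing b. The facts \<open>upper\<close> and
    \<open>attained\<close> below amount to v (\<nu> x) being the maximum over b of w b times the
    r-th power of the value of the b-th coordinate; definiteness and the ultrametric inequality
    follow from them.\<close>
  define w where "w b = v \<pi> ^ fst (g b)" for b
  have w: "0 < w b" for b using \<pi>(1) by (simp add: w_def v_pos)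
  have max: "\<exists>i<r. v (\<nu> x) = v (t i x) \<and> (\<forall>j<r. v (t j x) \<le> v (t i x))" for x
  proof -
    have "\<exists>i\<in>{..<r}. v (\<Sum>i\<in>{..<r}. t i x) = v (t i x) \<and> (\<forall>j\<in>{..<r}. v (t j x) \<le> v (t i x))"
      using r t_distinct by (intro v_sum_distinct) auto
    then show ?thesis by (auto simp: \<nu>_def)
  qed
  have upper: "w b * v (representation B x b) ^ r \<le> v (\<nu> x)" if b: "b \<in> B" for b x
  proof -
    have in_range: "fst (g b) < r" "snd (g b) < r" using g(2) b by auto
    obtain s where s: "v (t (fst (g b)) x) = v \<pi> ^ fst (g b) * v (Y (fst (g b)) s x) ^ r"
      "\<And>j. j < r \<Longrightarrow> v (Y (fst (g b)) j x) \<le> v (Y (fst (g b)) s x)"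
      using t by metis
    have "w b * v (representation B x b) ^ r \<le> v (t (fst (g b)) x)"
      unfolding s(1) w_def Y_coordinate[OF b, symmetric]
      using s(2)[OF in_range(2)] v_nonneg by (intro mult_left_mono power_mono) auto
    also have "\<dots> \<le> v (\<nu> x)" using max[of x] in_range(1) by auto
    finally show ?thesis .
  qed
  have attained: "v (\<nu> x) = 0 \<or> (\<exists>b\<in>B. v (\<nu> x) = w b * v (representation B x b) ^ r)" for x
  proof -
    obtain i s where val: "v (\<nu> x) = v \<pi> ^ i * v (Y i s x) ^ r"
      using max[of x] t by metis
    show ?thesis
      using Y_cases[of i s x]
    proof (elim disjE bexE conjE)
      assume "Y i s x = 0"
      then show ?thesis using val r by (simp add: v_0)
    next
      fix b assume "b \<in> B" "g b = (i, s)" "Y i s x = representation B x b"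
      then show ?thesis using val by (intro disjI2 bexI[of _ b]) (simp_all add: w_def)
    qed
  qed
  have \<nu>_0: "\<nu> x = 0 \<longleftrightarrow> x = 0" for x
  proof
    assume "\<nu> x = 0"
    show "x = 0"
    proof (rule rep_0)
      fix b assume "b \<in> B"
      then have "w b * v (representation B x b) ^ r \<le> 0"
        using upper[of b x] \<open>\<nu> x = 0\<close> by (simp add: v_0)
      then have "\<not> 0 < v (representation B x b) ^ r"
        using w[of b] by (simp add: mult_le_0_iff)
      then show "representation B x b = 0"
        using v_pos[of "representation B x b"] zero_less_power by blast
    qed
  next
    assume "x = 0"
    then have "v (representation B x b) ^ r = 0" for b
      using r by (simp add: representation_zero v_0)
    with attained[of x] have "v (\<nu> x) = 0" by fastforce
    then show "\<nu> x = 0" by (simp only: v_eq_0_iff)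
  qed
  have ultra: "v (\<nu> (x + y)) \<le> max (v (\<nu> x)) (v (\<nu> y))" for x y
    using attained[of "x + y"]
  proof (elim disjE bexE)
    fix b assume b: "b \<in> B" "v (\<nu> (x + y)) = w b * v (representation B (x + y) b) ^ r"
    \<comment> \<open>The ultrametric inequality of the field is needed only at the coordinate b
      where v (\<nu> (x + y)) is attained.\<close>
    obtain z where z: "z = x \<or> z = y" "v (representation B (x + y) b) \<le> v (representation B z b)"
      unfolding rep using ultrametric[of "representation B x b" "representation B y b"]
      by (auto simp: le_max_iff_disj)
    have "v (\<nu> (x + y)) \<le> w b * v (representation B z b) ^ r"
      unfolding b(2) using z(2) v_nonneg w[of b] by (intro mult_left_mono power_mono) auto
    also have "\<dots> \<le> v (\<nu> z)" by (rule upper[OF b(1)])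
    finally show ?thesis using z(1) by auto
  qed (simp add: v_nonneg le_max_iff_disj)
  have scale: "v (\<nu> (smul a x)) = v a ^ r * v (\<nu> x)" for a x
  proof -
    have Y: "Y i j (smul a x) = a * Y i j x" for i j
      by (simp add: Y_def rep)
    have "t i (smul a x) = a ^ r * t i x" for i
      unfolding t_def Y sum_distrib_left
    proof (rule sum.cong)
      fix \<alpha> assume "\<alpha> \<in> A"
      then have "(\<Prod>j<r. a ^ \<alpha> j) = a ^ r" by (simp add: A flip: power_sum)
      then show "\<pi> ^ i * (c \<alpha> * (\<Prod>j<r. (a * Y i j x) ^ \<alpha> j)) =
          a ^ r * (\<pi> ^ i * (c \<alpha> * (\<Prod>j<r. Y i j x ^ \<alpha> j)))"
        by (simp add: power_mult_distrib prod.distrib)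
    qed simp
    then have "\<nu> (smul a x) = a ^ r * \<nu> x"
      by (simp add: \<nu>_def sum_distrib_left)
    then show ?thesis by (simp add: v_mult v_power)
  qed
  have root_ultra: "root r (v (\<nu> (x + y))) \<le> max (root r (v (\<nu> x))) (root r (v (\<nu> y)))" for x y
    using ultra[of x y] r by (auto simp: le_max_iff_disj real_root_le_iff)
  have root_nonneg: "0 \<le> root r (v (\<nu> x))" for x
    using v_nonneg by (simp add: real_root_ge_zero)
  have "nonarchimedean_vector_norm v smul (\<lambda>x. root r (v (\<nu> x)))"
  proof unfold_locales
    fix x y a
    show "0 \<le> root r (v (\<nu> x))" by (rule root_nonneg)
    show "root r (v (\<nu> x)) = 0 \<longleftrightarrow> x = 0"
      using r by (simp add: v_eq_0_iff \<nu>_0)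
    show "root r (v (\<nu> (x + y))) \<le> root r (v (\<nu> x)) + root r (v (\<nu> y))"
      using root_ultra[of x y] root_nonneg[of x] root_nonneg[of y] by linarith
    show "root r (v (\<nu> (smul a x))) = v a * root r (v (\<nu> x))"
      using r v_nonneg[of a] by (simp add: scale real_root_mult real_root_power_cancel)
    show "root r (v (\<nu> (x + y))) \<le> max (root r (v (\<nu> x))) (root r (v (\<nu> y)))"
      by (rule root_ultra)
  qed
  with homogeneous \<nu>_0 show ?thesis unfolding definite_def by blast
qed

end

section \<open>Combination of the real and the non-archimedean case\<close>

theorem proposition3p1:
  fixes scaleV :: "real \<Rightarrow> 'v::ab_group_add \<Rightarrow> 'v" and B\<^sub>V :: "'v set"
    and \<nu>\<^sub>V :: "'v \<Rightarrow> real"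
    and absk :: "'k::topological_field \<Rightarrow> real"
    and scaleW :: "'k \<Rightarrow> 'w::ab_group_add \<Rightarrow> 'w" and B\<^sub>W :: "'w set"
    and m r :: nat
  shows
    "(finite_dimensional_vector_space scaleV B\<^sub>V \<and>
      quadratic_form scaleV B\<^sub>V \<nu>\<^sub>V \<and> positive_definite \<nu>\<^sub>V \<longrightarrow>
        vector_norm abs scaleV (\<lambda>x. sqrt \<bar>\<nu>\<^sub>V x\<bar>)) \<and>
     (local_field TYPE('k) \<and> nonarchimedean_abs_value absk \<and>
      finite_dimensional_vector_space scaleW B\<^sub>W \<and> vector_space.dim scaleW UNIV = m \<and>
      0 < r \<and> m \<le> r\<^sup>2 \<longrightarrow>
        (\<exists>\<nu>. homogeneous_polynomial scaleW B\<^sub>W r \<nu> \<and> definite \<nu> \<and>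
             nonarchimedean_vector_norm absk scaleW (\<lambda>x. root r (absk (\<nu> x)))))"
proof (intro conjI impI; elim conjE)
  assume "finite_dimensional_vector_space scaleV B\<^sub>V" "quadratic_form scaleV B\<^sub>V \<nu>\<^sub>V" "positive_definite \<nu>\<^sub>V"
  then show "vector_norm abs scaleV (\<lambda>x. sqrt \<bar>\<nu>\<^sub>V x\<bar>)"
    by (rule positive_definite_quadratic_form_norm)
next
  assume "local_field TYPE('k)" and v: "nonarchimedean_abs_value absk"
    and fd: "finite_dimensional_vector_space scaleW B\<^sub>W" and dim: "vector_space.dim scaleW UNIV = m"
    and r: "0 < r" and m: "m \<le> r\<^sup>2"
  then have loc: "locally compact (UNIV :: 'k set)" "\<not> (\<forall>S :: 'k set. open S)"
    by (simp_all add: local_field_def)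
  \<comment> \<open>The canonical absolute value comes with a Haar measure that it scales, which is
    the measure the locale asks for.\<close>
  obtain M where M: "haar_measure M"
    "\<And>a Y. Y \<in> sets borel \<Longrightarrow> emeasure M ((*) a ` Y) = ennreal (absk a) * emeasure M Y"
    and nonneg: "\<And>a. 0 \<le> absk a"
    using v unfolding nonarchimedean_abs_value_def canonical_abs_value_def by blast
  have "absk (a + b) \<le> max (absk a) (absk b)" for a b
    using v by (simp add: nonarchimedean_abs_value_def)
  then interpret nonarchimedean_local_field absk M
    using loc M nonneg by unfold_locales
  interpret W: finite_dimensional_vector_space scaleW B\<^sub>W by (rule fd)
  have "card B\<^sub>W \<le> r\<^sup>2"
    using dim m W.dim_UNIV by simp
  then show "\<exists>\<nu>. homogeneous_polynomial scaleW B\<^sub>W r \<nu> \<and> definite \<nu> \<and>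
      nonarchimedean_vector_norm absk scaleW (\<lambda>x. root r (absk (\<nu> x)))"
    by (rule ex_definite_form[OF fd r])
qed

end
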